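(* For a compact space $K$, the following conditions are equivalent: (i) $K$ is NY compact; (ii) there exists a $T_0$-separating family $\mathcal{U}=\bigcup\{\mathcal{U}_\gamma:\gamma\in\Gamma\}$ consisting of cozero subsets of $K$, where each $\mathcal{U}_\gamma$ is countable and the family $\{\bigcup\mathcal{U}_\gamma:\gamma\in\Gamma\}$ is point-finite; (iii) $K$ has a closure preserving cover consisting of metrizable compacta; (iv) $K$ is hereditarily metacompact and each nonempty subspace $A$ of $K$ contains a nonempty relatively open subspace $U$ of countable weight.
   Context: All topological spaces are assumed to be completely regular Hausdorff (Tikhonov). Given nonempty spaces $X_\gamma$ ($\gamma\in\Gamma$) and fixed points $a_\gamma\in X_\gamma$, the $\sigma$-product is $\sigma(X_\gamma,a_\gamma,\Gamma)=\{(x_\gamma)_{\gamma\in\Gamma}\in\prod_{\gamma\in\Gamma}X_\gamma:\ |\{\gamma\in\Gamma: x_\gamma\neq a_\gamma\}|<\omega\}$ with the topology inherited from the product. A compact space $K$ is NY compact if it can be embedded (homeomorphically) into some $\sigma$-product of metrizable compact spaces. A family $\mathcal{U}$ of subsets of $K$ is $T_0$-separating if for every pair of distinct points $x,y\in K$ there is $U\in\mathcal{U}$ containing exactly one of $x,y$. An (indexed) family of subsets is point-finite if every point belongs to only finitely many of its members. A cozero subset of $K$ is a set of the form $f^{-1}((0,1])$ for a continuous $f:K\to[0,1]$. A family $\mathcal{A}$ of subsets of a space $X$ is closure preserving if $\overline{\bigcup\mathcal{A}'}=\bigcup\{\overline{A}:A\in\mathcal{A}'\}$ for every subfamily $\mathcal{A}'\subseteq\mathcal{A}$.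 A space is metacompact if every open cover has a point-finite open refinement (covering the space), and hereditarily metacompact if every subspace is metacompact. The weight of a space is the minimal cardinality of a base. *)

theory Defs
  imports "HOL-Analysis.Analysis"
begin

definition sigma_product :: "('i \<Rightarrow> 'b topology) \<Rightarrow> ('i \<Rightarrow> 'b) \<Rightarrow> 'i set \<Rightarrow> ('i \<Rightarrow> 'b) topology"
  where "sigma_product X a \<Gamma> =
    subtopology (product_topology X \<Gamma>) {x. finite {\<gamma> \<in> \<Gamma>. x \<gamma> \<noteq> a \<gamma>}}"

text \<open>HOL cannot quantify over types inside a formula, so the index type and the type carrying the
  factors are fixed. This loses no generality: an embedding into a \<open>\<sigma>\<close>-product over any index type,
  with factors on any type, yields one of the kind below, see \<open>NY_compactI\<close>.\<close>

definition NY_compact :: "'a topology \<Rightarrow> bool"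
  where "NY_compact K \<longleftrightarrow> compact_space K \<and>
    (\<exists>(\<Gamma> :: ('a \<times> nat) set) (X :: 'a \<times> nat \<Rightarrow> (nat \<Rightarrow> real) topology) a f.
       (\<forall>\<gamma>\<in>\<Gamma>. a \<gamma> \<in> topspace (X \<gamma>) \<and> compact_space (X \<gamma>) \<and> metrizable_space (X \<gamma>)) \<and>
       embedding_map K (sigma_product X a \<Gamma>) f)"

definition T0_separating :: "'a topology \<Rightarrow> 'a set set \<Rightarrow> bool"
  where "T0_separating K \<U> \<longleftrightarrow>
    (\<forall>x \<in> topspace K. \<forall>y \<in> topspace K. x \<noteq> y \<longrightarrow> (\<exists>U\<in>\<U>. (x \<in> U) \<noteq> (y \<in> U)))"

text \<open>Point-finiteness counts indices: a nonempty set that occurs for infinitely many indices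
  violates it.\<close>

definition point_finite :: "'i set \<Rightarrow> ('i \<Rightarrow> 'a set) \<Rightarrow> bool"
  where "point_finite I A \<longleftrightarrow> (\<forall>x. finite {i \<in> I. x \<in> A i})"

definition cozero_in :: "'a topology \<Rightarrow> 'a set \<Rightarrow> bool"
  where "cozero_in K U \<longleftrightarrow>
    (\<exists>f. continuous_map K (top_of_set {0..1::real}) f \<and> U = {x \<in> topspace K. f x \<in> {0<..1}})"

definition closure_preserving :: "'a topology \<Rightarrow> 'a set set \<Rightarrow> bool"
  where "closure_preserving X \<A> \<longleftrightarrow>
    (\<forall>\<A>'. \<A>' \<subseteq> \<A> \<longrightarrow> X closure_of (\<Union>\<A>') = (\<Union>A\<in>\<A>'. X closure_of A))"

definition metacompact_space :: "'a topology \<Rightarrow> bool"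
  where "metacompact_space X \<longleftrightarrow>
    (\<forall>\<C>. (\<forall>C\<in>\<C>. openin X C) \<and> \<Union>\<C> = topspace X \<longrightarrow>
       (\<exists>\<V>. (\<forall>V\<in>\<V>. openin X V \<and> (\<exists>C\<in>\<C>. V \<subseteq> C)) \<and> \<Union>\<V> = topspace X \<and>
            point_finite \<V> (\<lambda>V. V)))"

definition hereditarily_metacompact :: "'a topology \<Rightarrow> bool"
  where "hereditarily_metacompact X \<longleftrightarrow>
    (\<forall>S \<subseteq> topspace X. metacompact_space (subtopology X S))"


subsection \<open>The fixed index and point types lose no generality\<close>

lemma point_finite_reindex:
  fixes A :: "'i \<Rightarrow> 'a set"
  assumes pf: "point_finite I A" and ne: "\<And>i. i \<in> I \<Longrightarrow> A i \<noteq> {}"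
  shows "\<exists>j :: 'i \<Rightarrow> 'a \<times> nat. inj_on j I"
proof -
  define p where "p i = (SOME x. x \<in> A i)" for i
  have p: "p i \<in> A i" if "i \<in> I" for i
    using ne [OF that] by (simp add: p_def some_in_eq)
  define F where "F x = {i \<in> I. x \<in> A i}" for x
  have F: "countable (F x)" for x
    using pf by (auto simp: F_def point_finite_def intro: countable_finite)
  have "inj_on (\<lambda>i. (p i, to_nat_on (F (p i)) i)) I"
  proof (rule inj_onI)
    fix i k assume ik: "i \<in> I" "k \<in> I"
      and eq: "(p i, to_nat_on (F (p i)) i) = (p k, to_nat_on (F (p k)) k)"
    then have "i \<in> F (p i)" "k \<in> F (p i)"
      using p [of i] p [of k] by (simp_all add: F_def)
    with eq F show "i = k"
      by (metis Pair_inject to_nat_on_inj)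
  qed
  then show ?thesis by blast
qed

lemma compact_metrizable_embeds_Hilbert:
  assumes "compact_space X" "metrizable_space X"
  obtains e :: "'b \<Rightarrow> nat \<Rightarrow> real" where "embedding_map X (powertop_real UNIV) e"
proof -
  obtain M d where Md: "Metric_space M d" and X: "X = Metric_space.mtopology M d"
    using assms(2) unfolding metrizable_space_def by blast
  interpret Metric_space M d by (rule Md)
  have "mtotally_bounded M"
    using assms(1) compact_space_eq_mcomplete_mtotally_bounded unfolding X by blast
  then have "\<forall>n::nat. \<exists>C. finite C \<and> C \<subseteq> M \<and> M \<subseteq> (\<Union>x\<in>C. mball x (1 / real (Suc n)))"
    unfolding mtotally_bounded_def by (metis divide_pos_pos of_nat_0_less_iff zero_less_Suc zero_less_one)
  then obtain C where C: "\<And>n::nat. finite (C n) \<and> C n \<subseteq> M \<and> M \<subseteq> (\<Union>x\<in>C n. mball x (1 / real (Suc n)))"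
    by metis
  define D where "D = (\<Union>n. C n)"
  have cD: "countable D" "D \<subseteq> M"
    using C by (auto simp: D_def intro: countable_finite)
  define e where "e = (\<lambda>x n. if from_nat_into D n \<in> D then d x (from_nat_into D n) else 0)"
  have cont: "continuous_map X (powertop_real UNIV) e"
    unfolding continuous_map_componentwise_UNIV
  proof
    fix n
    show "continuous_map X euclideanreal (\<lambda>x. e x n)"
    proof (cases "from_nat_into D n \<in> D")
      case True
      then have "from_nat_into D n \<in> M" using cD by blast
      then have "continuous_map X euclideanreal (\<lambda>x. d x (from_nat_into D n))"
        using continuous_map_mdist [of X "metric (M, d)" "\<lambda>x. x" "\<lambda>x. from_nat_into D n"]
        unfolding X mtopology_of_def by simp
      with True show ?thesis by (simp add: e_def)
    next
      case False
      then show ?thesis by (simp add: e_def)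
    qed
  qed
  have "inj_on e (topspace X)"
  proof (rule inj_onI)
    fix x y assume "x \<in> topspace X" "y \<in> topspace X" and eq: "e x = e y"
    then have xy: "x \<in> M" "y \<in> M" by (auto simp: X)
    have dd: "d x z = d y z" if z: "z \<in> D" for z
    proof -
      obtain n where "from_nat_into D n = z"
        using from_nat_into_surj [OF cD(1) z] by blast
      with z show ?thesis using fun_cong [OF eq, of n] by (simp add: e_def)
    qed
    show "x = y"
    proof (rule ccontr)
      assume "x \<noteq> y"
      then have pos: "d x y > 0" using xy by simp
      obtain n where n: "1 / real (Suc n) < d x y / 2"
        using nat_approx_posE [of "d x y / 2"] pos by auto
      obtain z where z: "z \<in> C n" "x \<in> mball z (1 / real (Suc n))"
        using C [of n] xy by blast
      then have "z \<in> D" "z \<in> M" "d z x < 1 / real (Suc n)"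
        by (auto simp: D_def)
      moreover have "d x y \<le> d x z + d z y"
        using xy \<open>z \<in> M\<close> triangle by blast
      ultimately show False
        using dd [of z] n by (simp add: commute)
    qed
  qed
  moreover have "Hausdorff_space (powertop_real (UNIV :: nat set))"
    by (simp add: Hausdorff_space_product_topology)
  ultimately have "embedding_map X (powertop_real UNIV) e"
    using continuous_imp_embedding_map assms(1) cont by blast
  then show thesis by (rule that)
qed

lemma topspace_sigma_product:
  "topspace (sigma_product X a \<Gamma>) =
    {x \<in> \<Pi>\<^sub>E \<gamma>\<in>\<Gamma>. topspace (X \<gamma>). finite {\<gamma> \<in> \<Gamma>. x \<gamma> \<noteq> a \<gamma>}}"
  by (auto simp: sigma_product_def)

proposition NY_compactI:
  fixes K :: "'a topology" and X :: "'i \<Rightarrow> 'b topology" and \<Gamma> :: "'i set"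
  assumes K: "compact_space K"
    and X: "\<And>\<gamma>. \<gamma> \<in> \<Gamma> \<Longrightarrow> a \<gamma> \<in> topspace (X \<gamma>) \<and> compact_space (X \<gamma>) \<and> metrizable_space (X \<gamma>)"
    and f: "embedding_map K (sigma_product X a \<Gamma>) f"
  shows "NY_compact K"
proof -
  have fc: "continuous_map K (product_topology X \<Gamma>) f"
    using f unfolding embedding_map_def homeomorphic_eq_everything_map sigma_product_def
    by (auto simp: continuous_map_in_subtopology)
  have fi: "inj_on f (topspace K)"
    using f unfolding embedding_map_def homeomorphic_eq_everything_map by blast
  have ft: "f x \<in> topspace (sigma_product X a \<Gamma>)" if "x \<in> topspace K" for x
    using f that unfolding embedding_map_def homeomorphic_eq_everything_map
    by (metis continuous_map_image_subset_topspace continuous_map_in_subtopology image_subset_iff)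
  define S where "S \<gamma> = {x \<in> topspace K. f x \<gamma> \<noteq> a \<gamma>}" for \<gamma>
  define \<Delta> where "\<Delta> = {\<gamma> \<in> \<Gamma>. S \<gamma> \<noteq> {}}"
  have "point_finite \<Delta> S"
    unfolding point_finite_def
  proof
    fix x
    show "finite {\<gamma> \<in> \<Delta>. x \<in> S \<gamma>}"
    proof (cases "x \<in> topspace K")
      case True
      then have "finite {\<gamma> \<in> \<Gamma>. f x \<gamma> \<noteq> a \<gamma>}"
        using ft topspace_sigma_product by blast
      then show ?thesis
        by (rule rev_finite_subset) (auto simp: \<Delta>_def S_def)
    qed (simp add: S_def)
  qed
  then obtain j :: "'i \<Rightarrow> 'a \<times> nat" where j: "inj_on j \<Delta>"
    using point_finite_reindex [of \<Delta> S] unfolding \<Delta>_def by blast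
  have "\<forall>\<gamma>\<in>\<Gamma>. \<exists>e::'b \<Rightarrow> nat \<Rightarrow> real. embedding_map (X \<gamma>) (powertop_real UNIV) e"
    using X compact_metrizable_embeds_Hilbert by metis
  then obtain e :: "'i \<Rightarrow> 'b \<Rightarrow> nat \<Rightarrow> real"
    where e: "\<And>\<gamma>. \<gamma> \<in> \<Gamma> \<Longrightarrow> embedding_map (X \<gamma>) (powertop_real UNIV) (e \<gamma>)"
    by metis
  define k where "k = inv_into \<Delta> j"
  have k: "k i \<in> \<Gamma>" "k i \<in> \<Delta>" if "i \<in> j ` \<Delta>" for i
    using that inv_into_into [of i j \<Delta>] by (auto simp: k_def \<Delta>_def)
  have kj: "k (j \<gamma>) = \<gamma>" if "\<gamma> \<in> \<Delta>" for \<gamma>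
    using j that by (simp add: k_def)
  define Y where "Y i = subtopology (powertop_real UNIV) (e (k i) ` topspace (X (k i)))" for i
  define b where "b i = e (k i) (a (k i))" for i
  define g where "g x = restrict (\<lambda>i. e (k i) (f x (k i))) (j ` \<Delta>)" for x
  have hom: "homeomorphic_map (X (k i)) (Y i) (e (k i))" if "i \<in> j ` \<Delta>" for i
    using e [OF k(1) [OF that]] by (simp add: Y_def embedding_map_def)
  have einj: "inj_on (e (k i)) (topspace (X (k i)))" if "i \<in> j ` \<Delta>" for i
    using hom [OF that] by (simp add: homeomorphic_eq_everything_map)
  have fX: "f x \<gamma> \<in> topspace (X \<gamma>)" if "x \<in> topspace K" "\<gamma> \<in> \<Gamma>" for x \<gamma>
    using ft [OF that(1)] that(2) by (auto simp: topspace_sigma_product)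
  have Y: "b i \<in> topspace (Y i) \<and> compact_space (Y i) \<and> metrizable_space (Y i)"
    if "i \<in> j ` \<Delta>" for i
  proof -
    have hs: "X (k i) homeomorphic_space Y i"
      using hom [OF that] homeomorphic_map_imp_homeomorphic_space by blast
    show ?thesis
      using X [OF k(1) [OF that]] homeomorphic_compact_space [OF hs]
        homeomorphic_metrizable_space [OF hs] by (auto simp: b_def Y_def)
  qed
  have gfin: "finite {i \<in> j ` \<Delta>. g x i \<noteq> b i}" if x: "x \<in> topspace K" for x
  proof -
    have "finite {\<gamma> \<in> \<Gamma>. f x \<gamma> \<noteq> a \<gamma>}"
      using ft [OF x] topspace_sigma_product by blast
    then have "finite (j ` {\<gamma> \<in> \<Gamma>. f x \<gamma> \<noteq> a \<gamma>})" by simp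
    then show ?thesis
    proof (rule rev_finite_subset)
      show "{i \<in> j ` \<Delta>. g x i \<noteq> b i} \<subseteq> j ` {\<gamma> \<in> \<Gamma>. f x \<gamma> \<noteq> a \<gamma>}"
      proof
        fix i assume "i \<in> {i \<in> j ` \<Delta>. g x i \<noteq> b i}"
        then obtain \<gamma> where \<gamma>: "\<gamma> \<in> \<Delta>" "i = j \<gamma>" "g x i \<noteq> b i" by blast
        then have "f x \<gamma> \<noteq> a \<gamma>" by (auto simp: g_def b_def kj)
        with \<gamma> show "i \<in> j ` {\<gamma> \<in> \<Gamma>. f x \<gamma> \<noteq> a \<gamma>}" by (simp add: \<Delta>_def)
      qed
    qed
  qed
  have "continuous_map K (product_topology Y (j ` \<Delta>)) g"
    unfolding continuous_map_componentwise
  proof (intro conjI ballI)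
    show "g ` topspace K \<subseteq> extensional (j ` \<Delta>)" by (auto simp: g_def)
    fix i assume i: "i \<in> j ` \<Delta>"
    have "continuous_map K (X (k i)) (\<lambda>x. f x (k i))"
      using fc k(1) [OF i] unfolding continuous_map_componentwise by blast
    moreover have "continuous_map (X (k i)) (Y i) (e (k i))"
      using hom [OF i] by (simp add: homeomorphic_imp_continuous_map)
    ultimately have "continuous_map K (Y i) (e (k i) \<circ> (\<lambda>x. f x (k i)))"
      by (rule continuous_map_compose)
    then show "continuous_map K (Y i) (\<lambda>x. g x i)"
      using i by (simp add: g_def o_def)
  qed
  then have gc: "continuous_map K (sigma_product Y b (j ` \<Delta>)) g"
    unfolding sigma_product_def continuous_map_in_subtopology using gfin by auto
  have "inj_on g (topspace K)"
  proof (rule inj_onI)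
    fix x y assume x: "x \<in> topspace K" and y: "y \<in> topspace K" and eq: "g x = g y"
    have "f x \<gamma> = f y \<gamma>" for \<gamma>
    proof -
      consider "\<gamma> \<in> \<Delta>" | "\<gamma> \<in> \<Gamma>" "\<gamma> \<notin> \<Delta>" | "\<gamma> \<notin> \<Gamma>" by blast
      then show ?thesis
      proof cases
        case 1
        then have "e \<gamma> (f x \<gamma>) = e \<gamma> (f y \<gamma>)"
          using fun_cong [OF eq, of "j \<gamma>"] by (simp add: g_def kj)
        moreover have "\<gamma> \<in> \<Gamma>" using 1 by (simp add: \<Delta>_def)
        ultimately show ?thesis
          using einj [of "j \<gamma>"] 1 fX [OF x, of \<gamma>] fX [OF y, of \<gamma>]
          by (auto simp: kj inj_on_def)
      next
        case 2
        then show ?thesis using x y by (auto simp: \<Delta>_def S_def)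
      next
        case 3
        then show ?thesis using ft [OF x] ft [OF y]
          by (auto simp: topspace_sigma_product PiE_def extensional_def)
      qed
    qed
    then have "f x = f y" by blast
    then show "x = y" using fi x y by (simp add: inj_on_def)
  qed
  moreover have "\<forall>i \<in> j ` \<Delta>. Hausdorff_space (Y i)"
    using Y metrizable_imp_Hausdorff_space by blast
  then have "Hausdorff_space (sigma_product Y b (j ` \<Delta>))"
    by (simp add: sigma_product_def Hausdorff_space_subtopology Hausdorff_space_product_topology)
  ultimately have "embedding_map K (sigma_product Y b (j ` \<Delta>)) g"
    using continuous_imp_embedding_map K gc by blast
  with K Y show ?thesis
    unfolding NY_compact_def by blast
qed

text \<open>Likewise a \<open>T\<^sub>0\<close>-separating family that is a union of countable families of cozero sets over any
  index type can be reindexed over \<open>'a \<times> nat\<close>: only indices with nonempty union matter.\<close>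

proposition point_finite_Union_reindex:
  fixes \<U> :: "'i \<Rightarrow> 'a set set"
  assumes sep: "T0_separating K (\<Union>\<gamma>\<in>\<Gamma>. \<U> \<gamma>)"
    and cz: "\<And>\<gamma>. \<gamma> \<in> \<Gamma> \<Longrightarrow> countable (\<U> \<gamma>) \<and> (\<forall>U \<in> \<U> \<gamma>. cozero_in K U)"
    and pf: "point_finite \<Gamma> (\<lambda>\<gamma>. \<Union>(\<U> \<gamma>))"
  shows "\<exists>(\<Delta> :: ('a \<times> nat) set) \<V>. T0_separating K (\<Union>\<gamma>\<in>\<Delta>. \<V> \<gamma>) \<and>
    (\<forall>\<gamma>\<in>\<Delta>. countable (\<V> \<gamma>) \<and> (\<forall>U \<in> \<V> \<gamma>. cozero_in K U)) \<and>
    point_finite \<Delta> (\<lambda>\<gamma>. \<Union>(\<V> \<gamma>))"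
proof -
  define \<Gamma>' where "\<Gamma>' = {\<gamma> \<in> \<Gamma>. \<Union>(\<U> \<gamma>) \<noteq> {}}"
  have pf': "point_finite \<Gamma>' (\<lambda>\<gamma>. \<Union>(\<U> \<gamma>))"
    unfolding point_finite_def
  proof
    fix x
    have "finite {\<gamma> \<in> \<Gamma>. x \<in> \<Union>(\<U> \<gamma>)}"
      using pf by (simp add: point_finite_def)
    then show "finite {\<gamma> \<in> \<Gamma>'. x \<in> \<Union>(\<U> \<gamma>)}"
      by (rule rev_finite_subset) (auto simp: \<Gamma>'_def)
  qed
  obtain j :: "'i \<Rightarrow> 'a \<times> nat" where j: "inj_on j \<Gamma>'"
    using point_finite_reindex [OF pf'] unfolding \<Gamma>'_def by blast
  define \<V> where "\<V> = \<U> \<circ> inv_into \<Gamma>' j"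
  have V: "\<V> (j \<gamma>) = \<U> \<gamma>" if "\<gamma> \<in> \<Gamma>'" for \<gamma>
    using j that by (simp add: \<V>_def)
  have "T0_separating K (\<Union>\<gamma>\<in>j ` \<Gamma>'. \<V> \<gamma>)"
    unfolding T0_separating_def
  proof (intro ballI impI)
    fix x y assume "x \<in> topspace K" "y \<in> topspace K" "x \<noteq> y"
    then obtain \<gamma> U where U: "\<gamma> \<in> \<Gamma>" "U \<in> \<U> \<gamma>" "(x \<in> U) \<noteq> (y \<in> U)"
      using sep unfolding T0_separating_def by blast
    then have "\<gamma> \<in> \<Gamma>'" by (auto simp: \<Gamma>'_def)
    then have "U \<in> (\<Union>\<gamma>\<in>j ` \<Gamma>'. \<V> \<gamma>)"
      using U(2) V by (intro UN_I [of "j \<gamma>"]) auto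
    with U(3) show "\<exists>U\<in>\<Union>\<gamma>\<in>j ` \<Gamma>'. \<V> \<gamma>. (x \<in> U) \<noteq> (y \<in> U)" by blast
  qed
  moreover have "\<forall>\<gamma>\<in>j ` \<Gamma>'. countable (\<V> \<gamma>) \<and> (\<forall>U \<in> \<V> \<gamma>. cozero_in K U)"
    using cz V by (auto simp: \<Gamma>'_def)
  moreover have "point_finite (j ` \<Gamma>') (\<lambda>\<gamma>. \<Union>(\<V> \<gamma>))"
    unfolding point_finite_def
  proof
    fix x
    have "{i \<in> j ` \<Gamma>'. x \<in> \<Union>(\<V> i)} = j ` {\<gamma> \<in> \<Gamma>'. x \<in> \<Union>(\<U> \<gamma>)}"
    proof (intro equalityI subsetI)
      fix i assume "i \<in> {i \<in> j ` \<Gamma>'. x \<in> \<Union>(\<V> i)}"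
      then obtain \<gamma> where "\<gamma> \<in> \<Gamma>'" "i = j \<gamma>" "x \<in> \<Union>(\<V> (j \<gamma>))" by blast
      with V show "i \<in> j ` {\<gamma> \<in> \<Gamma>'. x \<in> \<Union>(\<U> \<gamma>)}" by simp
    qed (use V in force)
    then show "finite {i \<in> j ` \<Gamma>'. x \<in> \<Union>(\<V> i)}"
      using pf' by (simp add: point_finite_def)
  qed
  ultimately show ?thesis by blast
qed

end

(* (ii) is a reformulation of (i), and (ii) gives (iii) by collecting, for each finite set F of indices,
   the points that no member with index outside F contains.

   (iii) ==> (iv). For a closure preserving cover the cell of y is the intersection of the members
   containing y; all unions of cells are closed, so the star {y. x : cell y} of x is open. Every closed
   set C has points with minimal cell, and finitely many cells cover all of them. There is no decreasing
   sequence of nonempty closed sets each of which avoids the minimal points of its predecessor. This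
   yields the second countable open parts, and also the following retractions: if a set X of points is
   closed under suitable finitary operations with countably many values, then the points of the union
   Z of the cells of X are separated by functions attached to X, and every point of K agrees with a
   (unique) point of Z on all these functions. Writing an uncountable X as a well-ordered union of
   smaller sets X_a, each point y has only finitely many a such that its retraction to Z_a is not yet in an
   earlier Z_b. Hence point-finite refinements of the pieces of Z_a outside the earlier Z_b,
   pulled back along the retractions, combine to one for Z, by induction on the cardinality of X.

   (iv) ==> (ii). The open sets carrying a system as in (ii) are closed under arbitrary unions, by
   metacompactness, and each one other than K can be enlarged by a second countable piece. *)

theory Submission
  imports Defs
begin

section \<open>Cozero sets and countable separating families\<close>

text \<open>The obstacle in (iii) to (iv) is that a closure preserving cover carries no countability
  and no point-finiteness, so refinements have to be glued along chains of subspaces, limit stages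
  included. Two facts make this work. Arbitrary unions of cells are closed, so removing all earlier
  stages from an open set leaves an open set. Unions of chains of sets closed under finitary
  operations are closed under them again, so there is a retraction also to the union of any sequence
  of stages; this is what keeps the new stages at a point finite in number. The operations imitate
  Skolem functions: from finitely many points they form all rational boxes in the functions attached
  to these points, and return representatives of the minimal cells of each box. In (iv) to (ii),
  metacompactness yields point-finite families of open sets only. They can be replaced by cozero
  sets because the closures of the members are arranged to stay inside the union.\<close>

lemma cozero_in_greaterI:
  assumes "continuous_map K euclideanreal f"
  shows "cozero_in K {x \<in> topspace K. q < f x}"
  unfolding cozero_in_def
proof (intro exI conjI)
  show "continuous_map K (top_of_set {0..1}) (\<lambda>x. min 1 (max 0 (f x - q)))"
    using assms by (auto simp: continuous_map_in_subtopology
        intro!: continuous_map_real_min continuous_map_real_max continuous_map_diff)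
qed auto

lemma cozero_inE:
  assumes "cozero_in K U"
  obtains f where "continuous_map K euclideanreal f" "\<And>x. x \<in> topspace K \<Longrightarrow> f x \<in> {0..1}"
    "U = {x \<in> topspace K. 0 < f x}"
proof -
  obtain f where f: "continuous_map K (top_of_set {0..1::real}) f"
    "U = {x \<in> topspace K. f x \<in> {0<..1}}"
    using assms unfolding cozero_in_def by blast
  then have "continuous_map K euclideanreal f" "\<And>x. x \<in> topspace K \<Longrightarrow> f x \<in> {0..1}"
    by (auto simp: continuous_map_in_subtopology)
  moreover from this(2) have "U = {x \<in> topspace K. 0 < f x}"
    using f(2) by auto
  ultimately show thesis by (rule that)
qed

lemma cozero_in_Int:
  assumes "cozero_in K U" "cozero_in K V"
  shows "cozero_in K (U \<inter> V)"
proof -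
  obtain f where f: "continuous_map K euclideanreal f" "U = {x \<in> topspace K. 0 < f x}"
    by (rule cozero_inE [OF assms(1)])
  obtain g where g: "continuous_map K euclideanreal g" "V = {x \<in> topspace K. 0 < g x}"
    by (rule cozero_inE [OF assms(2)])
  have "U \<inter> V = {x \<in> topspace K. 0 < min (f x) (g x)}"
    using f g by auto
  with cozero_in_greaterI [OF continuous_map_real_min [OF f(1) g(1)]] show ?thesis by simp
qed

lemma openin_continuous_map_less:
  assumes "continuous_map K euclideanreal f"
  shows "openin K {x \<in> topspace K. q < f x}" "openin K {x \<in> topspace K. f x < q}"
  using openin_continuous_map_preimage [OF assms, of "{q<..}"]
    openin_continuous_map_preimage [OF assms, of "{..<q}"] by auto

lemma cozero_in_imp_openin: "cozero_in K U \<Longrightarrow> openin K U"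
  by (elim cozero_inE) (simp add: openin_continuous_map_less)

lemma compact_Hausdorff_cozero_between:
  assumes "compact_space K" "Hausdorff_space K" "closedin K E" "openin K V" "E \<subseteq> V"
  obtains C where "cozero_in K C" "E \<subseteq> C" "C \<subseteq> V"
proof -
  have "normal_space K"
    using assms compact_Hausdorff_or_regular_imp_normal_space by blast
  moreover have "closedin K (topspace K - V)" "disjnt (topspace K - V) E"
    using assms by (auto simp: disjnt_def)
  ultimately obtain f where f: "continuous_map K euclideanreal f"
    "f ` (topspace K - V) \<subseteq> {0::real}" "f ` E \<subseteq> {1}"
    by (rule Urysohn_lemma_alt [OF _ _ assms(3)])
  show thesis
  proof
    show "cozero_in K {x \<in> topspace K. 0 < f x}"
      by (rule cozero_in_greaterI) (rule f)
    show "E \<subseteq> {x \<in> topspace K. 0 < f x}"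
      using f closedin_subset [OF assms(3)] by force
    show "{x \<in> topspace K. 0 < f x} \<subseteq> V"
      using f by force
  qed
qed

lemma compact_Hausdorff_cozero_nbhd:
  assumes "compact_space K" "Hausdorff_space K" "openin K V" "x \<in> V"
  obtains C where "cozero_in K C" "x \<in> C" "C \<subseteq> V"
proof -
  have "closedin K {x}"
    using assms by (meson closedin_Hausdorff_singleton openin_subset subsetD)
  then obtain C where "cozero_in K C" "{x} \<subseteq> C" "C \<subseteq> V"
    using compact_Hausdorff_cozero_between [OF assms(1,2) _ assms(3), of "{x}"] assms(4) by auto
  then show thesis by (intro that) auto
qed

text \<open>One function is kept for each pair of basic sets that some continuous function on
  \<open>K\<close> separates at the level 1/2; a Urysohn function for \<open>p\<close> and
  \<open>q\<close> shows that such a pair surrounds them. \<open>P\<close> and \<open>Q\<close> may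
  be non-closed, like the relatively open pieces in (iv), and distinct, so that points of two
  different cells can be told apart.\<close>

lemma second_countable_separating_functions:
  assumes K: "compact_space K" "Hausdorff_space K"
    and P: "P \<subseteq> topspace K" "second_countable (subtopology K P)"
    and Q: "Q \<subseteq> topspace K" "second_countable (subtopology K Q)"
  shows "\<exists>\<Phi>. countable \<Phi> \<and> (\<forall>f\<in>\<Phi>. continuous_map K euclideanreal f) \<and>
    (\<forall>p\<in>P. \<forall>q\<in>Q. p \<noteq> q \<longrightarrow> (\<exists>f\<in>\<Phi>. f p \<noteq> f q))"
proof -
  obtain \<B> where \<B>: "countable \<B>"
    "\<forall>U x. openin (subtopology K P) U \<and> x \<in> U \<longrightarrow> (\<exists>B\<in>\<B>. x \<in> B \<and> B \<subseteq> U)"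
    using P(2) unfolding second_countable_def by blast
  obtain \<C> where \<C>: "countable \<C>"
    "\<forall>U x. openin (subtopology K Q) U \<and> x \<in> U \<longrightarrow> (\<exists>B\<in>\<C>. x \<in> B \<and> B \<subseteq> U)"
    using Q(2) unfolding second_countable_def by blast
  define S where "S = (\<lambda>(B, C) f. continuous_map K euclideanreal f \<and>
    (\<forall>x\<in>B. f x < 1/2) \<and> (\<forall>x\<in>C. 1/2 < f x))"
  define \<Phi> where "\<Phi> = (\<lambda>z. SOME f. S z f) ` {z \<in> \<B> \<times> \<C>. \<exists>f. S z f}"
  have S: "S z (SOME f. S z f)" if "\<exists>f. S z f" for z
    using that by (rule someI_ex)
  show ?thesis
  proof (intro exI [of _ \<Phi>] conjI ballI impI)
    show "countable \<Phi>"
      unfolding \<Phi>_def using countable_SIGMA [of \<B> "\<lambda>_. \<C>"] \<B> \<C>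
      by (intro countable_image) (auto intro: countable_subset [rotated])
    show "continuous_map K euclideanreal f" if "f \<in> \<Phi>" for f
      using that S by (auto simp: \<Phi>_def S_def split: prod.splits)
    fix p q assume pq: "p \<in> P" "q \<in> Q" "p \<noteq> q"
    have "normal_space K"
      using K compact_Hausdorff_or_regular_imp_normal_space by blast
    moreover have "closedin K {p}" "closedin K {q}"
      using K pq P Q by (meson closedin_Hausdorff_singleton subsetD)+
    ultimately obtain g where g: "continuous_map K euclideanreal g" "g p = (0::real)" "g q = 1"
      using Urysohn_lemma_alt [of K "{p}" "{q}" 0 1] pq by auto
    have "openin (subtopology K P) (P \<inter> {x \<in> topspace K. g x < 1/2})"
      by (intro openin_subtopology_Int2 openin_continuous_map_less g)
    moreover have "p \<in> P \<inter> {x \<in> topspace K. g x < 1/2}"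
      using pq P g by auto
    ultimately obtain B where B: "B \<in> \<B>" "p \<in> B" "B \<subseteq> P \<inter> {x \<in> topspace K. g x < 1/2}"
      using \<B>(2) by blast
    have "openin (subtopology K Q) (Q \<inter> {x \<in> topspace K. 1/2 < g x})"
      by (intro openin_subtopology_Int2 openin_continuous_map_less g)
    moreover have "q \<in> Q \<inter> {x \<in> topspace K. 1/2 < g x}"
      using pq Q g by auto
    ultimately obtain C where C: "C \<in> \<C>" "q \<in> C" "C \<subseteq> Q \<inter> {x \<in> topspace K. 1/2 < g x}"
      using \<C>(2) by blast
    note BC = B C
    have "S (B, C) g"
      using g(1) BC by (auto simp: S_def)
    then have ex: "\<exists>f. S (B, C) f" by blast
    define f where "f = (SOME f. S (B, C) f)"
    have "f \<in> \<Phi>"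
      unfolding \<Phi>_def f_def using BC ex by blast
    moreover have "S (B, C) f"
      using S [OF ex] by (simp only: f_def)
    then have "f p < 1/2" "1/2 < f q"
      using BC by (auto simp: S_def)
    then have "f p \<noteq> f q" by linarith
    ultimately show "\<exists>f\<in>\<Phi>. f p \<noteq> f q" by blast
  qed
qed

lemma second_countable_euclidean:
  "second_countable (euclidean :: 'b::second_countable_topology topology)"
proof -
  obtain \<B> :: "'b set set" where "countable \<B>" "\<And>B. B \<in> \<B> \<Longrightarrow> open B"
    "\<And>S. open S \<Longrightarrow> \<exists>U. U \<subseteq> \<B> \<and> S = \<Union>U"
    using univ_second_countable by metis
  then show ?thesis
    unfolding second_countable_def by (intro exI [of _ \<B>]) (force simp flip: open_openin)
qed

lemma compact_metrizable_imp_second_countable: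
  assumes "compact_space X" "metrizable_space X"
  shows "second_countable X"
proof -
  obtain e where "embedding_map X (powertop_real (UNIV :: nat set)) e"
    by (rule compact_metrizable_embeds_Hilbert [OF assms])
  then have "X homeomorphic_space subtopology euclidean (e ` topspace X)"
    unfolding embedding_map_def euclidean_product_topology
    by (rule homeomorphic_map_imp_homeomorphic_space)
  then show ?thesis
    using homeomorphic_space_second_countability second_countable_subtopology
      second_countable_euclidean by blast
qed

lemma compact_separating_functions_imp_metrizable:
  fixes \<Phi> :: "('a \<Rightarrow> real) set"
  assumes "compact_space X" "countable \<Phi>"
    and cont: "\<And>f. f \<in> \<Phi> \<Longrightarrow> continuous_map X euclideanreal f"
    and sep: "\<And>p q. p \<in> topspace X \<Longrightarrow> q \<in> topspace X \<Longrightarrow> p \<noteq> q \<Longrightarrow> \<exists>f\<in>\<Phi>. f p \<noteq> f q"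
  shows "metrizable_space X"
proof -
  define e where "e x = (\<lambda>f\<in>\<Phi>. f x)" for x
  have "continuous_map X (powertop_real \<Phi>) e"
    unfolding continuous_map_componentwise using cont by (auto simp: e_def)
  moreover have "inj_on e (topspace X)"
    using sep by (fastforce simp: inj_on_def e_def restrict_def fun_eq_iff)
  ultimately have "embedding_map X (powertop_real \<Phi>) e"
    using continuous_imp_embedding_map assms(1)
    by (metis Hausdorff_space_euclidean Hausdorff_space_product_topology)
  then have "X homeomorphic_space subtopology (powertop_real \<Phi>) (e ` topspace X)"
    unfolding embedding_map_def by (rule homeomorphic_map_imp_homeomorphic_space)
  moreover have "metrizable_space (powertop_real \<Phi>)"
    unfolding metrizable_space_product_topology
    using assms(2) metrizable_space_euclidean by (auto intro: countable_subset)
  ultimately show ?thesis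
    using homeomorphic_metrizable_space metrizable_space_subtopology by blast
qed

section \<open>\<open>\<sigma>\<close>-products, cozero systems and closure preserving covers\<close>

definition point_finite_cozero_system :: "'a topology \<Rightarrow> 'i set \<Rightarrow> ('i \<Rightarrow> 'a set set) \<Rightarrow> bool"
  where "point_finite_cozero_system K \<Gamma> \<U> \<longleftrightarrow>
    T0_separating K (\<Union>\<gamma>\<in>\<Gamma>. \<U> \<gamma>) \<and>
    (\<forall>\<gamma>\<in>\<Gamma>. countable (\<U> \<gamma>) \<and> (\<forall>U \<in> \<U> \<gamma>. cozero_in K U)) \<and>
    point_finite \<Gamma> (\<lambda>\<gamma>. \<Union>(\<U> \<gamma>))"

lemma NY_compact_imp_point_finite_cozero_system:
  fixes K :: "'a topology"
  assumes "NY_compact K"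
  shows "\<exists>(\<Gamma> :: ('a \<times> nat) set) \<U>. point_finite_cozero_system K \<Gamma> \<U>"
proof -
  obtain \<Gamma> :: "('a \<times> nat) set" and X :: "'a \<times> nat \<Rightarrow> (nat \<Rightarrow> real) topology" and a f
    where X: "\<forall>\<gamma>\<in>\<Gamma>. a \<gamma> \<in> topspace (X \<gamma>) \<and> compact_space (X \<gamma>) \<and> metrizable_space (X \<gamma>)"
      and f: "embedding_map K (sigma_product X a \<Gamma>) f"
    using assms unfolding NY_compact_def by blast
  have fc: "continuous_map K (product_topology X \<Gamma>) f"
    and ft: "f ` topspace K \<subseteq> topspace (sigma_product X a \<Gamma>)"
    using f unfolding embedding_map_def homeomorphic_eq_everything_map sigma_product_def
    by (auto simp: continuous_map_in_subtopology)
  have fi: "inj_on f (topspace K)"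
    using f unfolding embedding_map_def homeomorphic_eq_everything_map by blast
  have f\<Gamma>: "f x \<in> (\<Pi>\<^sub>E \<gamma>\<in>\<Gamma>. topspace (X \<gamma>))" "finite {\<gamma> \<in> \<Gamma>. f x \<gamma> \<noteq> a \<gamma>}"
    if "x \<in> topspace K" for x
    using ft that by (auto simp: topspace_sigma_product)
  have "\<forall>\<gamma>\<in>\<Gamma>. \<exists>e :: (nat \<Rightarrow> real) \<Rightarrow> nat \<Rightarrow> real. embedding_map (X \<gamma>) (powertop_real UNIV) e"
    using X compact_metrizable_embeds_Hilbert by metis
  then obtain e :: "'a \<times> nat \<Rightarrow> (nat \<Rightarrow> real) \<Rightarrow> nat \<Rightarrow> real"
    where e: "\<forall>\<gamma>\<in>\<Gamma>. embedding_map (X \<gamma>) (powertop_real UNIV) (e \<gamma>)"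
    by metis
  have ei: "inj_on (e \<gamma>) (topspace (X \<gamma>))"
    and ec: "continuous_map (X \<gamma>) (powertop_real UNIV) (e \<gamma>)" if "\<gamma> \<in> \<Gamma>" for \<gamma>
    using e that unfolding embedding_map_def homeomorphic_eq_everything_map
    by (auto simp: continuous_map_in_subtopology)
  define h where "h \<gamma> n s x = s * e \<gamma> (f x \<gamma>) n" for \<gamma> n and s :: real and x
  \<comment> \<open>The sign \<open>s\<close> provides rays in both directions. The condition on
    \<open>q\<close> keeps the base point out of every member, so \<open>x\<close> lies in a member
    with index \<open>\<gamma>\<close> only if \<open>f x \<gamma> \<noteq> a \<gamma>\<close>. A
    rational between two values of a coordinate still gives an admissible ray in one of the two
    directions.\<close>
  define I where "I \<gamma> = {(n, s, q). s \<in> {1, -1} \<and> q \<in> \<rat> \<and> s * e \<gamma> (a \<gamma>) n \<le> q}" for \<gamma>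
  define \<U> where "\<U> \<gamma> = (\<lambda>(n, s, q). {x \<in> topspace K. q < h \<gamma> n s x}) ` I \<gamma>" for \<gamma>
  have hc: "continuous_map K euclideanreal (h \<gamma> n s)" if "\<gamma> \<in> \<Gamma>" for \<gamma> n s
  proof -
    have "continuous_map K (X \<gamma>) (\<lambda>x. f x \<gamma>)"
      using fc that unfolding continuous_map_componentwise by blast
    then have "continuous_map K (powertop_real UNIV) (\<lambda>x. e \<gamma> (f x \<gamma>))"
      using continuous_map_compose [OF _ ec [OF that]] by (simp add: o_def)
    then have "continuous_map K euclideanreal (\<lambda>x. e \<gamma> (f x \<gamma>) n)"
      unfolding continuous_map_componentwise_UNIV by blast
    then show ?thesis
      unfolding h_def by (intro continuous_map_real_mult) auto
  qed
  have "T0_separating K (\<Union>\<gamma>\<in>\<Gamma>. \<U> \<gamma>)"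
    unfolding T0_separating_def
  proof (intro ballI impI)
    fix x y assume x: "x \<in> topspace K" and y: "y \<in> topspace K" and "x \<noteq> y"
    then have "f x \<noteq> f y"
      using fi by (auto simp: inj_on_def)
    then obtain \<gamma> where \<gamma>: "\<gamma> \<in> \<Gamma>" "f x \<gamma> \<noteq> f y \<gamma>"
      using PiE_ext [OF f\<Gamma>(1) [OF x] f\<Gamma>(1) [OF y]] by blast
    then have "e \<gamma> (f x \<gamma>) \<noteq> e \<gamma> (f y \<gamma>)"
      using ei [OF \<gamma>(1)] f\<Gamma>(1) [OF x] f\<Gamma>(1) [OF y] by (auto simp: inj_on_def)
    then obtain n where n: "e \<gamma> (f x \<gamma>) n \<noteq> e \<gamma> (f y \<gamma>) n" by blast
    have U: "{x \<in> topspace K. q < h \<gamma> n s x} \<in> (\<Union>\<gamma>\<in>\<Gamma>. \<U> \<gamma>)"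
      if "s \<in> {1, -1}" "q \<in> \<rat>" "s * e \<gamma> (a \<gamma>) n \<le> q" for s q
      using that \<gamma>(1) unfolding \<U>_def I_def by force
    have sep: "\<exists>U\<in>\<Union>\<gamma>\<in>\<Gamma>. \<U> \<gamma>. (z \<in> U) \<noteq> (w \<in> U)"
      if zw: "z \<in> topspace K" "w \<in> topspace K" and less: "e \<gamma> (f z \<gamma>) n < e \<gamma> (f w \<gamma>) n" for z w
    proof -
      obtain q where q: "q \<in> \<rat>" "e \<gamma> (f z \<gamma>) n < q" "q < e \<gamma> (f w \<gamma>) n"
        using Rats_dense_in_real [OF less] by blast
      show ?thesis
      proof (cases "e \<gamma> (a \<gamma>) n \<le> q")
        case True
        then show ?thesis
          using U [of 1 q] q zw by (intro bexI [where x = "{x \<in> topspace K. q < h \<gamma> n 1 x}"]) (auto simp: h_def)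
      next
        case False
        then show ?thesis
          using U [of "-1" "-q"] q zw
          by (intro bexI [where x = "{x \<in> topspace K. -q < h \<gamma> n (-1) x}"]) (auto simp: h_def)
      qed
    qed
    show "\<exists>U\<in>\<Union>\<gamma>\<in>\<Gamma>. \<U> \<gamma>. (x \<in> U) \<noteq> (y \<in> U)"
      using n sep [OF x y] sep [OF y x] by (meson linorder_neqE)
  qed
  moreover have "countable (\<U> \<gamma>)" for \<gamma>
  proof -
    have "I \<gamma> \<subseteq> UNIV \<times> {1, -1} \<times> \<rat>" by (auto simp: I_def)
    then have "countable (I \<gamma>)"
      by (rule countable_subset) (intro countable_SIGMA countable_rat; simp)
    then show ?thesis by (simp add: \<U>_def)
  qed
  moreover have "cozero_in K U" if "\<gamma> \<in> \<Gamma>" "U \<in> \<U> \<gamma>" for \<gamma> U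
    using that(2) by (auto simp: \<U>_def intro!: cozero_in_greaterI hc [OF that(1)])
  moreover have "point_finite \<Gamma> (\<lambda>\<gamma>. \<Union>(\<U> \<gamma>))"
    unfolding point_finite_def
  proof
    fix x
    show "finite {\<gamma> \<in> \<Gamma>. x \<in> \<Union>(\<U> \<gamma>)}"
    proof (cases "x \<in> topspace K")
      case True
      show ?thesis
        by (rule finite_subset [OF _ f\<Gamma>(2) [OF True]]) (auto simp: \<U>_def I_def h_def)
    next
      case False
      then have "{\<gamma> \<in> \<Gamma>. x \<in> \<Union>(\<U> \<gamma>)} = {}" by (auto simp: \<U>_def)
      then show ?thesis by (simp only: finite.emptyI)
    qed
  qed
  ultimately have "point_finite_cozero_system K \<Gamma> \<U>"
    unfolding point_finite_cozero_system_def by (intro conjI ballI)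
  then show ?thesis by (intro exI)
qed

text \<open>All factors are the cube of sequences in [0,1], with base point 0. The functions
  attached to \<open>\<gamma>\<close> vanish off \<open>\<Union>(\<U> \<gamma>)\<close>, so
  point-finiteness becomes finiteness of supports; every member is the positivity set of some
  coordinate, so separation becomes injectivity.\<close>

lemma point_finite_cozero_system_imp_NY_compact:
  assumes K: "compact_space K" and sys: "point_finite_cozero_system K \<Gamma> \<U>"
  shows "NY_compact K"
proof -
  define R where "R \<gamma> F \<longleftrightarrow> (\<forall>n. continuous_map K (top_of_set {0..1}) (F n)) \<and>
      (\<forall>n. \<forall>x\<in>topspace K. F n x \<noteq> 0 \<longrightarrow> x \<in> \<Union>(\<U> \<gamma>)) \<and>
      (\<forall>U\<in>\<U> \<gamma>. \<exists>n. U = {x \<in> topspace K. F n x > 0})"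
    for \<gamma> and F :: "nat \<Rightarrow> 'a \<Rightarrow> real"
  have "\<exists>F. R \<gamma> F" if \<gamma>: "\<gamma> \<in> \<Gamma>" for \<gamma>
  proof -
    have "\<forall>U\<in>\<U> \<gamma>. \<exists>f. continuous_map K (top_of_set {0..1::real}) f \<and> U = {x \<in> topspace K. f x \<in> {0<..1}}"
      using sys \<gamma> unfolding point_finite_cozero_system_def cozero_in_def by blast
    then obtain g where g: "\<forall>U\<in>\<U> \<gamma>. continuous_map K (top_of_set {0..1::real}) (g U) \<and>
        U = {x \<in> topspace K. g U x \<in> {0<..1}}"
      by metis
    then have gc: "\<forall>U\<in>\<U> \<gamma>. continuous_map K (top_of_set {0..1::real}) (g U)" by blast
    have g01: "g U x \<in> {0..1}" if "U \<in> \<U> \<gamma>" "x \<in> topspace K" for U x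
    proof -
      show ?thesis
        using bspec [OF gc that(1)] that(2) by (auto simp: continuous_map_in_subtopology)
    qed
    have gU: "x \<in> U \<longleftrightarrow> x \<in> topspace K \<and> g U x > 0" if "U \<in> \<U> \<gamma>" for U x
    proof -
      have "U = {x \<in> topspace K. g U x \<in> {0<..1}}"
        using g that by blast
      then have "x \<in> U \<longleftrightarrow> x \<in> topspace K \<and> g U x \<in> {0<..1}" by blast
      then show ?thesis
        using g01 [OF that, of x] by auto
    qed
    \<comment> \<open>For an empty family the enumeration has no member to return, and the zero
      function fills all coordinates.\<close>
    define F where "F n = (if from_nat_into (\<U> \<gamma>) n \<in> \<U> \<gamma> then g (from_nat_into (\<U> \<gamma>) n) else (\<lambda>x. 0))" for n
    show ?thesis
      unfolding R_def
    proof (intro exI [of _ F] conjI allI ballI impI)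
      show "continuous_map K (top_of_set {0..1}) (F n)" for n
        using gc by (simp add: F_def)
      show "x \<in> \<Union>(\<U> \<gamma>)" if "x \<in> topspace K" "F n x \<noteq> 0" for n x
      proof (cases "from_nat_into (\<U> \<gamma>) n \<in> \<U> \<gamma>")
        case True
        then have "x \<in> from_nat_into (\<U> \<gamma>) n"
          using that g01 [OF True that(1)] gU [OF True, of x] by (simp add: F_def)
        then show ?thesis using True by blast
      next
        case False
        then show ?thesis using that by (simp add: F_def)
      qed
      fix U assume U: "U \<in> \<U> \<gamma>"
      moreover have "countable (\<U> \<gamma>)"
        using sys \<gamma> unfolding point_finite_cozero_system_def by blast
      ultimately obtain n where "from_nat_into (\<U> \<gamma>) n = U"
        using from_nat_into_surj by metis
      then show "\<exists>n. U = {x \<in> topspace K. F n x > 0}"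
        using U gU [OF U] by (intro exI [of _ n] set_eqI) (simp add: F_def)
    qed
  qed
  then obtain F where "\<forall>\<gamma>\<in>\<Gamma>. R \<gamma> (F \<gamma>)"
    by metis
  note F = this [unfolded R_def]
  define X :: "'b \<Rightarrow> (nat \<Rightarrow> real) topology"
    where "X = (\<lambda>\<gamma>. product_topology (\<lambda>n. top_of_set {0..1}) UNIV)"
  define \<phi> where "\<phi> x = (\<lambda>\<gamma>\<in>\<Gamma>. \<lambda>n. F \<gamma> n x)" for x
  have X: "(\<lambda>n. 0) \<in> topspace (X \<gamma>)" "compact_space (X \<gamma>)" "metrizable_space (X \<gamma>)" for \<gamma>
    by (auto simp: X_def compact_space_product_topology compact_space_subtopology
        metrizable_space_product_topology metrizable_space_subtopology metrizable_space_euclidean)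
  have "continuous_map K (product_topology X \<Gamma>) \<phi>"
    unfolding continuous_map_componentwise
  proof (intro conjI ballI)
    show "\<phi> ` topspace K \<subseteq> extensional \<Gamma>" by (auto simp: \<phi>_def)
    fix \<gamma> assume "\<gamma> \<in> \<Gamma>"
    then show "continuous_map K (X \<gamma>) (\<lambda>x. \<phi> x \<gamma>)"
      using F by (simp add: \<phi>_def X_def continuous_map_componentwise_UNIV)
  qed
  moreover have "finite {\<gamma> \<in> \<Gamma>. \<phi> x \<gamma> \<noteq> (\<lambda>n. 0)}" if "x \<in> topspace K" for x
  proof (rule finite_subset)
    show "{\<gamma> \<in> \<Gamma>. \<phi> x \<gamma> \<noteq> (\<lambda>n. 0)} \<subseteq> {\<gamma> \<in> \<Gamma>. x \<in> \<Union>(\<U> \<gamma>)}"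
      using F that by (fastforce simp: \<phi>_def)
    show "finite {\<gamma> \<in> \<Gamma>. x \<in> \<Union>(\<U> \<gamma>)}"
      using sys unfolding point_finite_cozero_system_def point_finite_def by blast
  qed
  ultimately have "continuous_map K (sigma_product X (\<lambda>\<gamma> n. 0) \<Gamma>) \<phi>"
    unfolding sigma_product_def continuous_map_in_subtopology by auto
  moreover have "inj_on \<phi> (topspace K)"
  proof (rule inj_onI, rule ccontr)
    fix x y assume xy: "x \<in> topspace K" "y \<in> topspace K" "\<phi> x = \<phi> y" "x \<noteq> y"
    then obtain \<gamma> U where U: "\<gamma> \<in> \<Gamma>" "U \<in> \<U> \<gamma>" "(x \<in> U) \<noteq> (y \<in> U)"
      using sys unfolding point_finite_cozero_system_def T0_separating_def by blast
    then obtain n where "U = {x \<in> topspace K. F \<gamma> n x > 0}"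
      using F by blast
    moreover have "F \<gamma> n x = F \<gamma> n y"
      using fun_cong [OF xy(3), of \<gamma>] U(1) by (auto simp: \<phi>_def fun_eq_iff)
    ultimately show False
      using U(3) xy by auto
  qed
  moreover have "\<forall>\<gamma>\<in>\<Gamma>. Hausdorff_space (X \<gamma>)"
    using X(3) metrizable_imp_Hausdorff_space by blast
  then have "Hausdorff_space (sigma_product X (\<lambda>\<gamma> n. 0) \<Gamma>)"
    by (simp add: sigma_product_def Hausdorff_space_subtopology Hausdorff_space_product_topology)
  ultimately have "embedding_map K (sigma_product X (\<lambda>\<gamma> n. 0) \<Gamma>) \<phi>"
    using continuous_imp_embedding_map K by blast
  then show ?thesis
    by (rule NY_compactI [OF K, rotated]) (use X in simp)
qed

text \<open>Points near \<open>x\<close> have at least the support of \<open>x\<close>, because the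
  finitely many open sets \<open>\<Union>(\<U> \<gamma>)\<close> containing \<open>x\<close> contain
  them too. Hence lying outside \<open>L F\<close> for all \<open>F\<close> of a collection is an
  open condition. Members with index outside \<open>F\<close> miss \<open>L F\<close>, so for finite
  \<open>F\<close> countably many functions separate its points.\<close>

lemma point_finite_cozero_system_imp_closure_preserving:
  assumes K: "compact_space K" and sys: "point_finite_cozero_system K \<Gamma> \<U>"
  shows "\<exists>\<A>. \<Union>\<A> = topspace K \<and> closure_preserving K \<A> \<and>
    (\<forall>A\<in>\<A>. compactin K A \<and> metrizable_space (subtopology K A))"
proof -
  define supp where "supp x = {\<gamma> \<in> \<Gamma>. x \<in> \<Union>(\<U> \<gamma>)}" for x
  define L where "L F = {x \<in> topspace K. supp x \<subseteq> F}" for F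
  have sep: "T0_separating K (\<Union>\<gamma>\<in>\<Gamma>. \<U> \<gamma>)"
    and cz: "\<forall>\<gamma>\<in>\<Gamma>. countable (\<U> \<gamma>) \<and> (\<forall>U \<in> \<U> \<gamma>. cozero_in K U)"
    and fin: "finite (supp x)" for x
    using sys unfolding point_finite_cozero_system_def point_finite_def supp_def by auto
  have op: "openin K (\<Union>(\<U> \<gamma>))" if "\<gamma> \<in> \<Gamma>" for \<gamma>
    using cz that cozero_in_imp_openin by blast
  have closed: "closedin K (\<Union>F\<in>\<F>. L F)" for \<F>
  proof -
    have "openin K (topspace K - (\<Union>F\<in>\<F>. L F))"
    proof (subst openin_subopen, intro ballI)
      fix x assume x: "x \<in> topspace K - (\<Union>F\<in>\<F>. L F)"
      let ?T = "topspace K \<inter> (\<Inter>\<gamma>\<in>supp x. \<Union>(\<U> \<gamma>))"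
      have "openin K ?T"
        by (rule openin_Int_Inter [OF finite_imageI [OF fin]]) (auto simp: supp_def op)
      moreover have "x \<in> ?T"
        using x by (auto simp: supp_def)
      moreover have "?T \<subseteq> topspace K - (\<Union>F\<in>\<F>. L F)"
      proof -
        have "supp x \<subseteq> supp t" if "t \<in> ?T" for t
          using that by (auto simp: supp_def)
        with x show ?thesis
          unfolding L_def by blast
      qed
      ultimately show "\<exists>T. openin K T \<and> x \<in> T \<and> T \<subseteq> topspace K - (\<Union>F\<in>\<F>. L F)" by blast
    qed
    then show ?thesis
      by (auto simp: closedin_def L_def)
  qed
  have closed1: "closedin K (L F)" for F
    using closed [of "{F}"] by simp
  have "metrizable_space (subtopology K (L F))" if F: "finite F" "F \<subseteq> \<Gamma>" for F
  proof -
    have "\<forall>U\<in>(\<Union>\<gamma>\<in>F. \<U> \<gamma>). \<exists>f. continuous_map K euclideanreal f \<and> U = {x \<in> topspace K. 0 < f x}"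
      using cz F cozero_inE by (metis UN_E subsetD)
    then obtain f where f: "\<forall>U\<in>(\<Union>\<gamma>\<in>F. \<U> \<gamma>). continuous_map K euclideanreal (f U) \<and> U = {x \<in> topspace K. 0 < f U x}"
      by metis
    show ?thesis
    proof (rule compact_separating_functions_imp_metrizable)
      show "compact_space (subtopology K (L F))"
        using K closed1 by (simp add: closedin_compact_space compact_space_subtopology)
      show "countable (f ` (\<Union>\<gamma>\<in>F. \<U> \<gamma>))"
        using F cz by (intro countable_image countable_UN) (auto simp: countable_finite)
      show "continuous_map (subtopology K (L F)) euclideanreal g" if "g \<in> f ` (\<Union>\<gamma>\<in>F. \<U> \<gamma>)" for g
        using that f by (auto intro: continuous_map_from_subtopology)
      fix p q assume pq: "p \<in> topspace (subtopology K (L F))" "q \<in> topspace (subtopology K (L F))" "p \<noteq> q"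
      then have "p \<in> topspace K" "q \<in> topspace K" by auto
      with \<open>p \<noteq> q\<close> obtain \<gamma> U where U: "\<gamma> \<in> \<Gamma>" "U \<in> \<U> \<gamma>" "(p \<in> U) \<noteq> (q \<in> U)"
        using sep unfolding T0_separating_def by blast
      then have "\<gamma> \<in> F"
        using pq by (auto simp: L_def supp_def)
      then have fU: "f U \<in> f ` (\<Union>\<gamma>\<in>F. \<U> \<gamma>)" "U = {x \<in> topspace K. 0 < f U x}"
        using U f by blast+
      have "z \<in> U \<longleftrightarrow> 0 < f U z" if "z \<in> topspace K" for z
        using fU(2) that by blast
      then have "f U p \<noteq> f U q"
        using U(3) pq by (metis IntD1 topspace_subtopology)
      with fU(1) show "\<exists>g\<in>f ` (\<Union>\<gamma>\<in>F. \<U> \<gamma>). g p \<noteq> g q" 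
        by (rule bexI [of "\<lambda>g. g p \<noteq> g q" "f U", rotated])
    qed
  qed
  moreover have "closure_preserving K {L F |F. finite F \<and> F \<subseteq> \<Gamma>}"
    unfolding closure_preserving_def
  proof (intro allI impI)
    fix \<A>' assume sub: "\<A>' \<subseteq> {L F |F. finite F \<and> F \<subseteq> \<Gamma>}"
    then have "\<A>' \<subseteq> L ` {F. finite F \<and> F \<subseteq> \<Gamma>}" by blast
    then obtain \<F> where "\<A>' = L ` \<F>"
      by (auto simp: subset_image_iff)
    then have "closedin K (\<Union>\<A>')"
      using closed [of \<F>] by simp
    moreover have "closedin K A" if "A \<in> \<A>'" for A
      using that sub closed1 by auto
    ultimately show "K closure_of \<Union>\<A>' = (\<Union>A\<in>\<A>'. K closure_of A)"
      by (simp add: closure_of_closedin)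
  qed
  moreover have "\<Union>{L F |F. finite F \<and> F \<subseteq> \<Gamma>} = topspace K"
  proof -
    have "x \<in> \<Union>{L F |F. finite F \<and> F \<subseteq> \<Gamma>}" if "x \<in> topspace K" for x
    proof (rule UnionI)
      show "L (supp x) \<in> {L F |F. finite F \<and> F \<subseteq> \<Gamma>}"
        using fin [of x] by (auto simp: supp_def)
      show "x \<in> L (supp x)"
        using that by (simp add: L_def)
    qed
    moreover have "L F \<subseteq> topspace K" for F by (auto simp: L_def)
    ultimately show ?thesis by (auto simp del: Union_iff)
  qed
  moreover have "compactin K (L F)" for F
    by (rule closedin_compact_space [OF K closed1])
  ultimately have "\<Union>{L F |F. finite F \<and> F \<subseteq> \<Gamma>} = topspace K \<and>
      closure_preserving K {L F |F. finite F \<and> F \<subseteq> \<Gamma>} \<and>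
      (\<forall>A\<in>{L F |F. finite F \<and> F \<subseteq> \<Gamma>}. compactin K A \<and> metrizable_space (subtopology K A))"
    by blast
  then show ?thesis by (rule exI)
qed

section \<open>Sets closed under finitary operations\<close>

unbundle cardinal_syntax

text \<open>\<open>T\<close> bundles all operations into one map: \<open>T F\<close> is the set of
  their values at the finite set \<open>F\<close>.\<close>

definition finitary_closed :: "('a set \<Rightarrow> 'a set) \<Rightarrow> 'a set \<Rightarrow> bool"
  where "finitary_closed T X \<longleftrightarrow> (\<forall>F. finite F \<and> F \<subseteq> X \<longrightarrow> T F \<subseteq> X)"

definition finitary_closure :: "('a set \<Rightarrow> 'a set) \<Rightarrow> 'a set \<Rightarrow> 'a set"
  where "finitary_closure T U = \<Inter>{X. U \<subseteq> X \<and> finitary_closed T X}"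

lemma subset_finitary_closure: "U \<subseteq> finitary_closure T U"
  by (auto simp: finitary_closure_def)

lemma finitary_closed_closure: "finitary_closed T (finitary_closure T U)"
  unfolding finitary_closed_def finitary_closure_def by (intro allI impI Inter_greatest) blast

lemma finitary_closure_least: "U \<subseteq> X \<Longrightarrow> finitary_closed T X \<Longrightarrow> finitary_closure T U \<subseteq> X"
  by (auto simp: finitary_closure_def)

lemma finitary_closure_mono: "U \<subseteq> V \<Longrightarrow> finitary_closure T U \<subseteq> finitary_closure T V"
  by (metis finitary_closed_closure finitary_closure_least subset_finitary_closure subset_trans)

lemma finite_subset_Union_directed:
  assumes "finite F" "F \<subseteq> \<Union>\<C>" "\<C> \<noteq> {}"
    and dir: "\<And>A B. A \<in> \<C> \<Longrightarrow> B \<in> \<C> \<Longrightarrow> \<exists>C\<in>\<C>. A \<union> B \<subseteq> C"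
  shows "\<exists>C\<in>\<C>. F \<subseteq> C"
  using assms(1,2)
proof (induction F)
  case empty
  then show ?case using \<open>\<C> \<noteq> {}\<close> by auto
next
  case (insert x F)
  then obtain A B where "A \<in> \<C>" "F \<subseteq> A" "B \<in> \<C>" "x \<in> B" by auto
  moreover obtain C where "C \<in> \<C>" "A \<union> B \<subseteq> C"
    using dir [OF \<open>A \<in> \<C>\<close> \<open>B \<in> \<C>\<close>] by blast
  ultimately show ?case by blast
qed

lemma finitary_closed_Union_directed:
  assumes "\<And>X. X \<in> \<C> \<Longrightarrow> finitary_closed T X" "\<C> \<noteq> {}"
    and dir: "\<And>A B. A \<in> \<C> \<Longrightarrow> B \<in> \<C> \<Longrightarrow> \<exists>C\<in>\<C>. A \<union> B \<subseteq> C"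
  shows "finitary_closed T (\<Union>\<C>)"
  unfolding finitary_closed_def
proof (intro allI impI)
  fix F assume "finite F \<and> F \<subseteq> \<Union>\<C>"
  then obtain C where "C \<in> \<C>" "F \<subseteq> C"
    using finite_subset_Union_directed [of F \<C>] assms by blast
  with \<open>finite F \<and> F \<subseteq> \<Union>\<C>\<close> show "T F \<subseteq> \<Union>\<C>"
    using assms(1) [OF \<open>C \<in> \<C>\<close>] unfolding finitary_closed_def by blast
qed

lemma card_of_Fpow_ordLeq_infinite:
  assumes "infinite U"
  shows "|Fpow U| \<le>o |U|"
proof -
  define P where "P n = {F. F \<subseteq> U \<and> finite F \<and> card F = n}" for n :: nat
  have "|P n| \<le>o |U|" for n
  proof (induction n)
    case 0
    have "P 0 = {{}}" by (auto simp: P_def)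
    then show ?case
      using assms card_of_singl_ordLeq [of U] by force
  next
    case (Suc n)
    have "P (Suc n) \<subseteq> (\<lambda>(x, F). insert x F) ` (U \<times> P n)"
    proof
      fix F assume "F \<in> P (Suc n)"
      then obtain x G where "F = insert x G" "x \<notin> G" "card G = n" "finite G" "F \<subseteq> U"
        by (auto simp: P_def card_Suc_eq)
      then show "F \<in> (\<lambda>(x, F). insert x F) ` (U \<times> P n)"
        by (intro image_eqI [where x = "(x, G)"]) (auto simp: P_def)
    qed
    moreover have "|U \<times> P n| \<le>o |U|"
      using assms card_of_Times_ordLeq_infinite_Field
        [OF _ card_of_mono1 [OF order_refl] Suc card_of_Card_order]
      by (simp add: Field_card_of)
    ultimately show ?case
      by (meson card_of_image card_of_mono1 ordLeq_transitive)
  qed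
  moreover have "|UNIV :: nat set| \<le>o |U|"
    using assms infinite_iff_card_of_nat by blast
  ultimately have "|\<Union>n\<in>UNIV. P n| \<le>o |U|"
    using card_of_UNION_ordLeq_infinite [OF assms, of UNIV P] by blast
  moreover have "Fpow U = (\<Union>n\<in>UNIV. P n)"
    by (auto simp: P_def Fpow_def)
  ultimately show ?thesis by simp
qed

text \<open>A downward Loewenheim-Skolem argument: countably many rounds of adding values suffice
  because the operations take finite sets as arguments, and a round does not raise an infinite
  cardinality because \<open>Fpow\<close> does not.\<close>

lemma card_of_finitary_closure:
  assumes T: "\<And>F. finite F \<Longrightarrow> countable (T F)" and U: "infinite U"
  shows "|finitary_closure T U| \<le>o |U|"
proof -
  define step where "step V = V \<union> (\<Union>F\<in>Fpow V. T F)" for V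
  define W where "W n = (step ^^ n) U" for n
  have W: "infinite (W n) \<and> |W n| \<le>o |U|" for n
  proof (induction n)
    case 0
    show ?case using U card_of_mono1 [OF order_refl] by (simp add: W_def)
  next
    case (Suc n)
    then have inf: "infinite (W n)" and le: "|W n| \<le>o |U|" by auto
    have "|T F| \<le>o |W n|" if "F \<in> Fpow (W n)" for F
    proof -
      have "countable (T F)" using T that by (auto simp: Fpow_def)
      then have "|T F| \<le>o |UNIV :: nat set|"
        unfolding countable_def card_of_ordLeq [symmetric] by auto
      moreover have "|UNIV :: nat set| \<le>o |W n|"
        using inf infinite_iff_card_of_nat by blast
      ultimately show ?thesis by (rule ordLeq_transitive)
    qed
    then have "|\<Union>F\<in>Fpow (W n). T F| \<le>o |W n|"
      using card_of_UNION_ordLeq_infinite [OF inf card_of_Fpow_ordLeq_infinite [OF inf]] by blast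
    from card_of_Un_ordLeq_infinite_Field
      [OF _ card_of_mono1 [OF order_refl] this card_of_Card_order]
    have "|step (W n)| \<le>o |W n|"
      unfolding step_def using inf
      by (simp add: Field_card_of)
    then have "|W (Suc n)| \<le>o |U|"
      using le ordLeq_transitive by (auto simp: W_def)
    moreover have "infinite (W (Suc n))"
      using inf by (simp add: W_def step_def)
    ultimately show ?case by blast
  qed
  have mono: "W m \<subseteq> W n" if "m \<le> n" for m n
    using that by (rule lift_Suc_mono_le [rotated]) (auto simp: W_def step_def)
  have "finitary_closed T (\<Union>n. W n)"
    unfolding finitary_closed_def
  proof (intro allI impI)
    fix F assume F: "finite F \<and> F \<subseteq> (\<Union>n. W n)"
    have "\<exists>C\<in>range W. F \<subseteq> C"
    proof (rule finite_subset_Union_directed)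
      fix A B assume "A \<in> range W" "B \<in> range W"
      then obtain m n where mn: "A = W m" "B = W n" by blast
      have "A \<union> B \<subseteq> W (max m n)"
        unfolding mn using mono [of m "max m n"] mono [of n "max m n"] by auto
      then show "\<exists>C\<in>range W. A \<union> B \<subseteq> C" by blast
    qed (use F in auto)
    then obtain n where "F \<subseteq> W n" by blast
    then have "T F \<subseteq> W (Suc n)"
      using F by (auto simp: W_def step_def Fpow_def)
    then show "T F \<subseteq> (\<Union>n. W n)" by blast
  qed
  moreover have "U \<subseteq> (\<Union>n. W n)"
    using UN_upper [of 0 UNIV W] by (simp add: W_def)
  ultimately have "finitary_closure T U \<subseteq> (\<Union>n. W n)"
    by (intro finitary_closure_least)
  moreover have "|\<Union>n\<in>UNIV. W n| \<le>o |U|"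
    using card_of_UNION_ordLeq_infinite [OF U, of UNIV W] W U infinite_iff_card_of_nat by blast
  ultimately show ?thesis
    by (meson card_of_mono1 ordLeq_transitive)
qed

text \<open>Induction on cardinality: an uncountable closed set is the union of a well-ordered
  increasing chain of closed sets of smaller cardinality.\<close>

lemma finitary_closed_induct:
  assumes T: "\<And>F. finite F \<Longrightarrow> countable (T F)"
    and X: "finitary_closed T X"
    and base: "\<And>X. finitary_closed T X \<Longrightarrow> countable X \<Longrightarrow> P X"
    and step: "\<And>X r Y. \<lbrakk>finitary_closed T X; well_order_on X r;
        \<And>a. a \<in> X \<Longrightarrow> finitary_closed T (Y a); \<And>a. a \<in> X \<Longrightarrow> P (Y a);
        \<And>a b. (a, b) \<in> r \<Longrightarrow> Y a \<subseteq> Y b; X = (\<Union>a\<in>X. Y a)\<rbrakk> \<Longrightarrow> P X"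
  shows "P X"
proof -
  have "wf (inv_image ordLess (\<lambda>X :: 'a set. |X| ))"
    using wf_ordLess by (rule wf_inv_image)
  then show ?thesis
    using X
  proof (induction X rule: wf_induct_rule)
    case (less X)
    show ?case
    proof (cases "countable X")
      case True
      with less.prems show ?thesis by (rule base)
    next
      case False
      then have inf: "infinite X" by (auto intro: countable_finite)
      \<comment> \<open>Initial segments may be finite. The seed \<open>Q\<close> makes every
        generating set infinite, as the bound for closures requires, and being countable it stays
        smaller than \<open>X\<close>.\<close>
      obtain Q where Q: "Q \<subseteq> X" "infinite Q" "countable Q"
        using infinite_countable_subset' [OF inf] by blast
      have card: "|V| <o |X|" if "countable V" for V :: "'a set"
      proof (rule ccontr)
        assume "\<not> |V| <o |X|"
        then have "|X| \<le>o |V|"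
          using card_of_Well_order not_ordLess_iff_ordLeq by blast
        then obtain f where "inj_on f X" "f ` X \<subseteq> V"
          unfolding card_of_ordLeq [symmetric] by blast
        then show False
          using that False by (meson countable_image_inj_on countable_subset)
      qed
      define r where "r = |X|"
      have r: "well_order_on X r" "Card_order r" "Field r = X"
        using card_of_card_order_on [of X] card_of_well_order_on [of X]
        by (simp_all add: r_def Field_card_of)
      \<comment> \<open>Since \<open>r\<close> is the cardinal order of \<open>X\<close>, each
        segment is smaller than \<open>X\<close>, and so is the closed set generated by it and
        \<open>Q\<close>. At a limit, \<open>Y a\<close> may exceed the union of the earlier
        sets.\<close>
      define Y where "Y a = finitary_closure T (under r a \<union> Q)" for a
      have under_mono: "under r a \<subseteq> under r b" if "(a, b) \<in> r" for a b
        using r(1) that unfolding well_order_on_def linear_order_on_def partial_order_on_def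
          preorder_on_def by (auto simp: under_def dest: transD)
      have underX: "under r a \<subseteq> X" for a
        using r(3) by (auto simp: under_def Field_def)
      show ?thesis
      proof (rule step [OF less.prems r(1)])
        show clo: "finitary_closed T (Y a)" for a
          unfolding Y_def by (rule finitary_closed_closure)
        show "Y a \<subseteq> Y b" if "(a, b) \<in> r" for a b
          unfolding Y_def using under_mono [OF that] by (intro finitary_closure_mono) auto
        show "P (Y a)" if a: "a \<in> X" for a
        proof (rule less.IH)
          have "|underS r a| <o |X|"
            using card_of_underS [OF r(2), of a] a by (simp add: r(3)) (simp add: r_def)
          moreover have "|{a} \<union> Q| <o |X|"
            using Q by (intro card) auto
          ultimately have "|underS r a \<union> ({a} \<union> Q)| <o |X|"
            using card_of_Un_ordLess_infinite [OF inf] by blast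
          moreover have "under r a \<union> Q \<subseteq> underS r a \<union> ({a} \<union> Q)"
            by (auto simp: under_def underS_def)
          ultimately have "|under r a \<union> Q| <o |X|"
            using card_of_mono1 ordLeq_ordLess_trans by blast
          moreover have "|Y a| \<le>o |under r a \<union> Q|"
            unfolding Y_def using Q by (intro card_of_finitary_closure T) auto
          ultimately show "(Y a, X) \<in> inv_image ordLess (\<lambda>X. |X| )"
            using ordLeq_ordLess_trans by auto
        qed (rule clo)
        show "X = (\<Union>a\<in>X. Y a)"
        proof (intro equalityI subsetI)
          fix a assume a: "a \<in> X"
          have "a \<in> under r a"
            using a r(1) unfolding well_order_on_def linear_order_on_def partial_order_on_def
              preorder_on_def by (auto simp: under_def refl_on_def)
          then show "a \<in> (\<Union>a\<in>X. Y a)"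
            using a subset_finitary_closure [of "under r a \<union> Q" T] by (auto simp: Y_def)
        next
          fix x assume "x \<in> (\<Union>a\<in>X. Y a)"
          then obtain a where "x \<in> Y a" by blast
          moreover have "Y a \<subseteq> X"
            unfolding Y_def using underX Q less.prems by (intro finitary_closure_least) auto
          ultimately show "x \<in> X" by blast
        qed
      qed
    qed
  qed
qed

section \<open>Cells of a closure preserving cover\<close>

lemma compact_space_Inter_chain_nonempty:
  assumes "compact_space X" "W \<noteq> {}"
    and closed: "\<And>w. w \<in> W \<Longrightarrow> closedin X (C w)" and ne: "\<And>w. w \<in> W \<Longrightarrow> C w \<noteq> {}"
    and chain: "\<And>v w. v \<in> W \<Longrightarrow> w \<in> W \<Longrightarrow> C v \<subseteq> C w \<or> C w \<subseteq> C v"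
  shows "(\<Inter>w\<in>W. C w) \<noteq> {}"
proof -
  have min: "\<exists>w\<in>W. C w \<subseteq> \<Inter>\<F>" if "finite \<F>" "\<F> \<subseteq> C ` W" for \<F>
    using that
  proof (induction \<F>)
    case empty
    then show ?case using \<open>W \<noteq> {}\<close> by auto
  next
    case (insert A \<F>)
    then obtain v w where vw: "v \<in> W" "C v \<subseteq> \<Inter>\<F>" "w \<in> W" "A = C w" by auto
    with chain [OF vw(1,3)] show ?case by auto
  qed
  have "\<Inter>\<F> \<noteq> {}" if "finite \<F> \<and> \<F> \<subseteq> C ` W" for \<F>
    using min [of \<F>] ne that by blast
  moreover have "closedin X A" if "A \<in> C ` W" for A
    using closed that by blast
  ultimately show ?thesis
    using \<open>compact_space X\<close> [unfolded compact_space_fip, rule_format, of "C ` W"] by simp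
qed

locale closure_preserving_compact_cover =
  fixes K :: "'a topology" and \<A> :: "'a set set"
  assumes compact: "compact_space K" and Hausdorff: "Hausdorff_space K"
    and cover: "\<Union>\<A> = topspace K" and preserving: "closure_preserving K \<A>"
    and compactin_mem: "\<And>A. A \<in> \<A> \<Longrightarrow> compactin K A"
begin

text \<open>The relation \<open>x \<in> cell y\<close> is a preorder on \<open>K\<close>: cells are
  its principal down-sets, stars its principal up-sets, and \<open>cell_mono\<close> is
  transitivity. No member contains a point outside \<open>K\<close>, so the cell of such a point is
  all of \<open>K\<close>.\<close>

definition cell :: "'a \<Rightarrow> 'a set"
  where "cell y = {x \<in> topspace K. \<forall>A\<in>\<A>. y \<in> A \<longrightarrow> x \<in> A}"

definition star :: "'a \<Rightarrow> 'a set"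
  where "star x = {y \<in> topspace K. x \<in> cell y}"

lemma cell_subset: "cell y \<subseteq> topspace K"
  by (auto simp: cell_def)

lemma mem_cell_self: "y \<in> topspace K \<Longrightarrow> y \<in> cell y"
  by (auto simp: cell_def)

lemma cell_mono: "x \<in> cell y \<Longrightarrow> cell x \<subseteq> cell y"
  by (auto simp: cell_def)

lemma mem_star_self: "x \<in> topspace K \<Longrightarrow> x \<in> star x"
  by (simp add: star_def mem_cell_self)

text \<open>The complement of the star is the union of the members that miss \<open>x\<close>. These
  are compact, hence closed, and closure preservation makes their union closed.\<close>

lemma openin_star:
  assumes "x \<in> topspace K"
  shows "openin K (star x)"
proof -
  let ?\<A>' = "{A \<in> \<A>. x \<notin> A}"
  have "closedin K A" if "A \<in> \<A>" for A
    using compactin_mem [OF that] Hausdorff by (rule compactin_imp_closedin [rotated])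
  then have "(\<Union>A\<in>?\<A>'. K closure_of A) = \<Union>?\<A>'"
    by (auto simp: closure_of_closedin)
  moreover have "K closure_of \<Union>?\<A>' = (\<Union>A\<in>?\<A>'. K closure_of A)"
    using preserving [unfolded closure_preserving_def, rule_format, of ?\<A>'] by simp
  ultimately have "closedin K (\<Union>?\<A>')"
    using closedin_closure_of [of K "\<Union>?\<A>'"] by simp
  moreover have "star x = topspace K - \<Union>?\<A>'"
    using assms by (auto simp: star_def cell_def)
  ultimately show ?thesis by auto
qed

text \<open>A union of cells is a down-set, so the star of a point outside is an open neighbourhood
  that misses it.\<close>

lemma closedin_UN_cell: "closedin K (\<Union>x\<in>X. cell x)"
proof -
  have "openin K (topspace K - (\<Union>x\<in>X. cell x))"
  proof (subst openin_subopen, intro ballI)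
    fix z assume z: "z \<in> topspace K - (\<Union>x\<in>X. cell x)"
    have "star z \<subseteq> topspace K - (\<Union>x\<in>X. cell x)"
      using z cell_mono by (fastforce simp: star_def)
    with z show "\<exists>T. openin K T \<and> z \<in> T \<and> T \<subseteq> topspace K - (\<Union>x\<in>X. cell x)"
      by (intro exI [of _ "star z"]) (simp add: openin_star mem_star_self)
  qed
  then show ?thesis
    using cell_subset by (auto simp: closedin_def)
qed

lemma closedin_cell: "closedin K (cell x)"
  using closedin_UN_cell [of "{x}"] by simp

text \<open>Minimality in a preorder: a point of \<open>C\<close> below \<open>z\<close> must be
  equivalent to \<open>z\<close>, that is, have the same cell.\<close>

definition minimal :: "'a set \<Rightarrow> 'a set"
  where "minimal C = {z \<in> C. \<forall>w\<in>C. w \<in> cell z \<longrightarrow> z \<in> cell w}"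

lemma minimal_subset: "minimal C \<subseteq> C"
  by (auto simp: minimal_def)

text \<open>Zorn's lemma, applied to complements of cells because \<open>subset_Zorn\<close>
  produces maximal sets. A chain of cells has a lower bound by compactness: the traces on the closed
  set \<open>C\<close> are nonempty and nested, and any common point has a smaller cell.\<close>

lemma ex_minimal:
  assumes C: "closedin K C" and y: "y \<in> C"
  shows "\<exists>z\<in>minimal C. z \<in> cell y"
proof -
  have top: "w \<in> topspace K" if "w \<in> C" for w
    using C that closedin_subset by blast
  have "\<exists>M\<in>(\<lambda>w. - cell w) ` (C \<inter> cell y). \<forall>X\<in>(\<lambda>w. - cell w) ` (C \<inter> cell y). M \<subseteq> X \<longrightarrow> X = M"
  proof (rule subset_Zorn)
    fix \<C> assume chain: "subset.chain ((\<lambda>w. - cell w) ` (C \<inter> cell y)) \<C>"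
    show "\<exists>U\<in>(\<lambda>w. - cell w) ` (C \<inter> cell y). \<forall>X\<in>\<C>. X \<subseteq> U"
    proof (cases "\<C> = {}")
      case True
      then show ?thesis
        using y mem_cell_self [OF top [OF y]] by auto
    next
      case False
      obtain W where W: "W \<subseteq> C \<inter> cell y" "\<C> = (\<lambda>w. - cell w) ` W"
        using chain unfolding subset.chain_def subset_image_iff by blast
      have "(\<Inter>w\<in>W. cell w \<inter> C) \<noteq> {}"
      proof (rule compact_space_Inter_chain_nonempty [OF compact])
        show "W \<noteq> {}" using False W by blast
        show "closedin K (cell w \<inter> C)" for w
          using closedin_cell C by (rule closedin_Int)
        show "cell w \<inter> C \<noteq> {}" if "w \<in> W" for w
          using mem_cell_self [OF top, of w] that W(1) by blast
        show "cell v \<inter> C \<subseteq> cell w \<inter> C \<or> cell w \<inter> C \<subseteq> cell v \<inter> C" if "v \<in> W" "w \<in> W" for v w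
        proof -
          have "\<forall>X\<in>\<C>. \<forall>Y\<in>\<C>. X \<subseteq> Y \<or> Y \<subseteq> X"
            using chain by (simp add: subset_chain_def)
          then have "- cell v \<subseteq> - cell w \<or> - cell w \<subseteq> - cell v"
            using that unfolding W(2) by (simp only: ball_simps)
          then show ?thesis by blast
        qed
      qed
      then obtain u where u: "\<forall>w\<in>W. u \<in> cell w \<inter> C" by blast
      have ucell: "cell u \<subseteq> cell w" if "w \<in> W" for w
        using u that cell_mono by blast
      obtain w where "w \<in> W" using False W by blast
      then have "u \<in> C \<inter> cell y"
        using u W cell_mono by blast
      moreover have "\<forall>X\<in>\<C>. X \<subseteq> - cell u"
        unfolding W(2) using ucell by blast
      ultimately show ?thesis by blast
    qed
  qed
  then obtain z where z: "z \<in> C \<inter> cell y"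
    "\<forall>X\<in>(\<lambda>w. - cell w) ` (C \<inter> cell y). - cell z \<subseteq> X \<longrightarrow> X = - cell z"
    by blast
  have "z \<in> cell w" if "w \<in> C" "w \<in> cell z" for w
  proof -
    have "w \<in> C \<inter> cell y" using that z cell_mono by blast
    moreover have "- cell z \<subseteq> - cell w" using that cell_mono by blast
    ultimately have "- cell w = - cell z" using z(2) by blast
    then show ?thesis
      using mem_cell_self top z by blast
  qed
  then have "z \<in> minimal C"
    using z by (auto simp: minimal_def)
  with z show ?thesis by blast
qed

text \<open>Every point of \<open>C\<close> lies above a minimal one, so the stars of the minimal
  points form an open cover of the compact set \<open>C\<close>. If a minimal \<open>w\<close> lies
  in the star of \<open>z \<in> C\<close>, minimality turns \<open>z \<in> cell w\<close> into
  \<open>w \<in> cell z\<close>; a finite subcover by stars thus gives finitely many cells.\<close>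

lemma minimal_finite_cells:
  assumes "closedin K C"
  obtains F where "finite F" "F \<subseteq> minimal C" "minimal C \<subseteq> (\<Union>z\<in>F. cell z)"
proof -
  have top: "minimal C \<subseteq> topspace K"
    using assms closedin_subset minimal_subset by blast
  have "compactin K C"
    using compact assms by (rule closedin_compact_space)
  moreover have "openin K U" if "U \<in> star ` minimal C" for U
    using that openin_star top by blast
  moreover have "C \<subseteq> \<Union>(star ` minimal C)"
  proof
    fix y assume "y \<in> C"
    then have "\<exists>z\<in>minimal C. z \<in> cell y" "y \<in> topspace K"
      using ex_minimal [OF assms] closedin_subset [OF assms] by auto
    then show "y \<in> \<Union>(star ` minimal C)"
      by (auto simp: star_def)
  qed
  ultimately obtain \<F> where \<F>: "finite \<F>" "\<F> \<subseteq> star ` minimal C" "C \<subseteq> \<Union>\<F>"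
    unfolding compactin_def by meson
  obtain F where F: "finite F" "F \<subseteq> minimal C" "\<F> = star ` F"
    using finite_subset_image [OF \<F>(1,2)] by blast
  have "minimal C \<subseteq> (\<Union>z\<in>F. cell z)"
  proof
    fix w assume w: "w \<in> minimal C"
    then have "w \<in> C" using minimal_subset by blast
    then obtain z where z: "z \<in> F" "z \<in> cell w"
      using \<F>(3) F(3) by (auto simp: star_def)
    then have "z \<in> C" using F minimal_subset by blast
    with w z have "w \<in> cell z"
      by (auto simp: minimal_def)
    with z show "w \<in> (\<Union>z\<in>F. cell z)" by blast
  qed
  with F that show thesis by blast
qed

text \<open>Otherwise a minimal point \<open>z\<close> of the intersection would lie in the star of a cluster point
  of minimal points \<open>p n \<in> cell z\<close> of the \<open>Y n\<close>, which makes \<open>z\<close> itself minimal in some \<open>Y n\<close>.\<close>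

lemma no_sequence_avoiding_minimal:
  assumes closed: "\<And>n. closedin K (Y n)" and dec: "decseq Y" and ne: "\<And>n. Y n \<noteq> {}"
    and avoid: "\<And>n. Y (Suc n) \<inter> minimal (Y n) = {}"
  shows False
proof -
  let ?Y = "\<Inter>n. Y n"
  have "closedin K ?Y"
    using closed by (intro closedin_INT) auto
  moreover obtain y where "y \<in> ?Y"
    using compact_space_imp_nest [OF compact closed ne dec] by blast
  ultimately obtain z where z: "z \<in> minimal ?Y"
    using ex_minimal by blast
  then have zY: "z \<in> Y n" for n
    using minimal_subset by blast
  have "\<forall>n. \<exists>p. p \<in> minimal (Y n) \<and> p \<in> cell z"
    using ex_minimal [OF closed zY] by blast
  then obtain p where p: "\<forall>n. p n \<in> minimal (Y n) \<and> p n \<in> cell z"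
    by metis
  have pY: "p n \<in> Y m" if "m \<le> n" for m n
    using p minimal_subset [of "Y n"] decseqD [OF dec that] by blast
  define B where "B m = K closure_of (p ` {m..})" for m
  have pt: "p n \<in> topspace K" for n
    using p cell_subset by blast
  have "B m \<noteq> {}" for m
    using closure_of_subset [of "p ` {m..}" K] pt by (auto simp: B_def)
  moreover have "decseq B"
    unfolding decseq_def B_def by (intro allI impI closure_of_mono image_mono) auto
  ultimately obtain q where q: "\<forall>m. q \<in> B m"
    using compact_space_imp_nest [OF compact, of B] by (auto simp: B_def)
  have "p ` {m..} \<subseteq> Y m" "p ` {m..} \<subseteq> cell z" for m
    using p pY by auto
  then have "B m \<subseteq> Y m" "B m \<subseteq> cell z" for m
    by (simp_all add: B_def closure_of_minimal closed closedin_cell)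
  then have qY: "q \<in> ?Y" "q \<in> cell z"
    using q by blast+
  \<comment> \<open>Minimality of \<open>z\<close> in the intersection is applied to the cluster
    point \<open>q\<close>, which lies below \<open>z\<close>. Once \<open>q\<close> is below some
    \<open>p n\<close>, so is \<open>z\<close>, and then \<open>z\<close> and \<open>p n\<close> are
    equivalent.\<close>
  then have zq: "z \<in> cell q" and qt: "q \<in> topspace K"
    using z cell_subset by (auto simp: minimal_def)
  have "q \<in> K closure_of (p ` {0..})"
    using q unfolding B_def by blast
  then obtain n where n: "p n \<in> star q"
    using openin_star [OF qt] mem_star_self [OF qt] unfolding in_closure_of by blast
  then have zp: "z \<in> cell (p n)"
    using zq cell_mono by (auto simp: star_def)
  have "z \<in> minimal (Y n)"
    unfolding minimal_def
  proof (intro CollectI conjI ballI impI zY)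
    fix w assume w: "w \<in> Y n" "w \<in> cell z"
    then have "w \<in> cell (p n)" using zp cell_mono by blast
    with w p have "p n \<in> cell w" by (auto simp: minimal_def)
    with zp cell_mono show "z \<in> cell w" by blast
  qed
  with avoid [of n] zY [of "Suc n"] show False by blast
qed

end

section \<open>Metrizable members: second countable open parts\<close>

locale closure_preserving_metrizable_cover = closure_preserving_compact_cover +
  assumes metrizable_mem: "\<And>A. A \<in> \<A> \<Longrightarrow> metrizable_space (subtopology K A)"
begin

lemma second_countable_cell:
  assumes "y \<in> topspace K"
  shows "second_countable (subtopology K (cell y))"
proof -
  obtain A where A: "A \<in> \<A>" "y \<in> A"
    using assms cover by blast
  then have "cell y \<subseteq> A" by (auto simp: cell_def)
  moreover have "second_countable (subtopology K A)"
    using compactin_mem [OF A(1)] metrizable_mem [OF A(1)]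
    by (simp add: compactin_subspace compact_metrizable_imp_second_countable)
  ultimately show ?thesis
    using second_countable_subtopology [of "subtopology K A" "cell y"]
    by (simp add: subtopology_subtopology inf.absorb2)
qed

text \<open>Cells are peeled off one at a time: either \<open>W \<inter> C\<close> lies inside
  \<open>cell x\<close>, or \<open>W - cell x\<close> is an open set that still meets
  \<open>C\<close> and whose trace is covered by the remaining cells.\<close>

lemma second_countable_open_part:
  assumes "finite F" "F \<subseteq> topspace K" "openin K W" "W \<inter> C \<noteq> {}" "W \<inter> C \<subseteq> (\<Union>x\<in>F. cell x)"
  shows "\<exists>V. openin K V \<and> V \<inter> C \<noteq> {} \<and> second_countable (subtopology K (V \<inter> C))"
  using assms
proof (induction F arbitrary: W)
  case empty
  then show ?case by auto
next
  case (insert x F)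
  show ?case
  proof (cases "W \<inter> C \<subseteq> cell x")
    case True
    have "second_countable (subtopology (subtopology K (cell x)) (W \<inter> C))"
      using insert.prems by (intro second_countable_subtopology second_countable_cell) auto
    with True insert.prems show ?thesis
      by (intro exI [of _ W]) (simp add: subtopology_subtopology inf.absorb2)
  next
    case False
    show ?thesis
    proof (rule insert.IH)
      show "openin K (W - cell x)"
        using insert.prems closedin_cell by (intro openin_diff) auto
    qed (use insert.prems False in auto)
  qed
qed

text \<open>Otherwise no nonempty trace of an open set on the closure of \<open>A\<close> is covered
  by finitely many cells. Each \<open>W n\<close> can then be shrunk to an open set whose closed
  trace avoids the cells over the minimal points of the previous one, which gives a sequence
  excluded by \<open>no_sequence_avoiding_minimal\<close>.\<close>

lemma ex_openin_second_countable:
  assumes A: "A \<subseteq> topspace K" "A \<noteq> {}"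
  shows "\<exists>U. U \<noteq> {} \<and> openin (subtopology K A) U \<and> second_countable (subtopology K U)"
proof (rule ccontr)
  assume neg: "\<not> ?thesis"
  \<comment> \<open>Minimal points are available in closed sets. An open set that meets the closure
    meets \<open>A\<close>, and countable weight passes from its trace on \<open>C\<close> to its
    trace on \<open>A\<close>.\<close>
  define C where "C = K closure_of A"
  have no: "\<not> second_countable (subtopology K (V \<inter> C))" if V: "openin K V" "V \<inter> C \<noteq> {}" for V
  proof
    assume "second_countable (subtopology K (V \<inter> C))"
    then have "second_countable (subtopology (subtopology K (V \<inter> C)) (A \<inter> V))"
      by (rule second_countable_subtopology)
    moreover have "V \<inter> C \<inter> (A \<inter> V) = A \<inter> V"
      using closure_of_subset [OF A(1)] by (auto simp: C_def)
    moreover have "A \<inter> V \<noteq> {}"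
      using V openin_Int_closure_of_eq_empty [OF V(1), of A] by (auto simp: C_def)
    moreover have "openin (subtopology K A) (A \<inter> V)"
      using V(1) by (rule openin_subtopology_Int2)
    ultimately show False
      using neg by (metis subtopology_subtopology)
  qed
  define Y where "Y W = K closure_of (W \<inter> C)" for W
  have closedY: "closedin K (Y W)" for W
    by (simp add: Y_def)
  have closedC: "closedin K C"
    by (simp add: C_def)
  have "\<exists>W. \<forall>n. (openin K (W n) \<and> W n \<inter> C \<noteq> {}) \<and>
      (Y (W (Suc n)) \<subseteq> W n \<inter> C \<and> Y (W (Suc n)) \<inter> minimal (Y (W n)) = {})"
  proof (rule dependent_nat_choice)
    have "topspace K \<inter> C \<noteq> {}"
      using A closure_of_subset [OF A(1)] by (auto simp: C_def)
    then show "\<exists>W. openin K W \<and> W \<inter> C \<noteq> {}"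
      using openin_topspace by blast
  next
    fix W and n :: nat
    assume W: "openin K W \<and> W \<inter> C \<noteq> {}"
    obtain F where F: "finite F" "F \<subseteq> minimal (Y W)" "minimal (Y W) \<subseteq> (\<Union>z\<in>F. cell z)"
      using minimal_finite_cells [OF closedY] by blast
    have "F \<subseteq> topspace K"
      using F(2) minimal_subset closedin_subset [OF closedY [of W]] by blast
    then have "\<not> W \<inter> C \<subseteq> (\<Union>z\<in>F. cell z)"
      using second_countable_open_part [OF F(1) _ _ _ , of W C] W no by blast
    then obtain p where p: "p \<in> W \<inter> C" "p \<in> W - (\<Union>z\<in>F. cell z)" by blast
    have "openin K (W - (\<Union>z\<in>F. cell z))"
      using W closedin_UN_cell by blast
    moreover have "neighbourhood_base_of (closedin K) K"
      using compact_Hausdorff_imp_regular_space [OF compact Hausdorff] neighbourhood_base_of_closedin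
      by blast
    ultimately obtain U V where UV: "openin K U" "closedin K V" "p \<in> U" "U \<subseteq> V"
      "V \<subseteq> W - (\<Union>z\<in>F. cell z)"
      using p(2) unfolding neighbourhood_base_of by meson
    have "U \<inter> C \<subseteq> V" "U \<inter> C \<subseteq> C"
      using UV by auto
    then have "Y U \<subseteq> V" "Y U \<subseteq> C"
      unfolding Y_def using UV closedC by (simp_all only: closure_of_minimal)
    then have "Y U \<subseteq> W \<inter> C \<and> Y U \<inter> minimal (Y W) = {}"
      using UV(5) F(3) by auto
    moreover have "openin K U \<and> U \<inter> C \<noteq> {}"
      using UV(1,3) p(1) by blast
    ultimately show "\<exists>U. (openin K U \<and> U \<inter> C \<noteq> {}) \<and>
        (Y U \<subseteq> W \<inter> C \<and> Y U \<inter> minimal (Y W) = {})" by blast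
  qed
  then obtain W where W: "\<forall>n. (openin K (W n) \<and> W n \<inter> C \<noteq> {}) \<and>
      (Y (W (Suc n)) \<subseteq> W n \<inter> C \<and> Y (W (Suc n)) \<inter> minimal (Y (W n)) = {})"
    by blast
  have sub: "W n \<inter> C \<subseteq> Y (W n)" for n
    unfolding Y_def using closedC by (intro closure_of_subset) (auto dest: closedin_subset)
  show False
  proof (rule no_sequence_avoiding_minimal)
    show "closedin K (Y (W n))" for n by (rule closedY)
    show "Y (W n) \<noteq> {}" for n
      using W sub by blast
    show "decseq (\<lambda>n. Y (W n))"
      unfolding decseq_Suc_iff using W sub by blast
    show "Y (W (Suc n)) \<inter> minimal (Y (W n)) = {}" for n
      using W by blast
  qed
qed

section \<open>Functions, boxes and models attached to sets of points\<close>

definition separators :: "'a \<Rightarrow> 'a \<Rightarrow> ('a \<Rightarrow> real) set"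
  where "separators x x' = (SOME \<Phi>. countable \<Phi> \<and> (\<forall>f\<in>\<Phi>. continuous_map K euclideanreal f) \<and>
    (\<forall>p\<in>cell x. \<forall>q\<in>cell x'. p \<noteq> q \<longrightarrow> (\<exists>f\<in>\<Phi>. f p \<noteq> f q)))"

text \<open>Like \<open>separators\<close>, a choice fixed once and for all. Both depend on their
  arguments alone and not on a surrounding set of points, so they can serve as operations under
  which sets are closed.\<close>

definition reps :: "'a set \<Rightarrow> 'a set"
  where "reps C = (SOME F. finite F \<and> F \<subseteq> minimal C \<and> minimal C \<subseteq> (\<Union>z\<in>F. cell z))"

lemma separators:
  assumes "x \<in> topspace K" "x' \<in> topspace K"
  shows "countable (separators x x')" "f \<in> separators x x' \<Longrightarrow> continuous_map K euclideanreal f"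
    "p \<in> cell x \<Longrightarrow> q \<in> cell x' \<Longrightarrow> p \<noteq> q \<Longrightarrow> \<exists>f\<in>separators x x'. f p \<noteq> f q"
proof -
  have "countable (separators x x') \<and> (\<forall>f\<in>separators x x'. continuous_map K euclideanreal f) \<and>
    (\<forall>p\<in>cell x. \<forall>q\<in>cell x'. p \<noteq> q \<longrightarrow> (\<exists>f\<in>separators x x'. f p \<noteq> f q))"
    unfolding separators_def
    by (rule someI_ex) (intro second_countable_separating_functions compact Hausdorff cell_subset
        second_countable_cell assms)
  then show "countable (separators x x')" "f \<in> separators x x' \<Longrightarrow> continuous_map K euclideanreal f"
    "p \<in> cell x \<Longrightarrow> q \<in> cell x' \<Longrightarrow> p \<noteq> q \<Longrightarrow> \<exists>f\<in>separators x x'. f p \<noteq> f q"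
    by simp_all
qed

lemma reps:
  assumes "closedin K C"
  shows "finite (reps C)" "reps C \<subseteq> topspace K" "minimal C \<subseteq> (\<Union>z\<in>reps C. cell z)"
proof -
  obtain F where F: "finite F" "F \<subseteq> minimal C" "minimal C \<subseteq> (\<Union>z\<in>F. cell z)"
    by (rule minimal_finite_cells [OF assms])
  have "finite (reps C) \<and> reps C \<subseteq> minimal C \<and> minimal C \<subseteq> (\<Union>z\<in>reps C. cell z)"
    unfolding reps_def by (rule someI [of _ F]) (intro conjI F)
  moreover have "minimal C \<subseteq> topspace K"
    using minimal_subset closedin_subset [OF assms] by blast
  ultimately show "finite (reps C)" "reps C \<subseteq> topspace K" "minimal C \<subseteq> (\<Union>z\<in>reps C. cell z)"
    by auto
qed

text \<open>Points outside \<open>K\<close> are dropped so that \<open>countable_box_reps\<close>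
  holds for every finite set, as \<open>finitary_closed_induct\<close> requires.\<close>

definition separators_on :: "'a set \<Rightarrow> ('a \<Rightarrow> real) set"
  where "separators_on X = (\<Union>x\<in>X \<inter> topspace K. \<Union>x'\<in>X \<inter> topspace K. separators x x')"

text \<open>The conditions come as a list: lists over a countable set are countable in number, and
  appending them intersects the boxes.\<close>

definition box :: "(('a \<Rightarrow> real) \<times> real \<times> real) list \<Rightarrow> 'a set"
  where "box l = {y \<in> topspace K. \<forall>(f, a, b)\<in>set l. a \<le> f y \<and> f y \<le> b}"

definition box_reps :: "'a set \<Rightarrow> 'a set"
  where "box_reps F = (\<Union>l\<in>lists (separators_on F \<times> \<rat> \<times> \<rat>). reps (box l))"

text \<open>The counterpart of an elementary submodel: such a set contains the representatives of
  all rational boxes over it, which is what forces its region to meet the fibre of every point in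
  \<open>ex_region_same_separators\<close>.\<close>

definition model :: "'a set \<Rightarrow> bool"
  where "model X \<longleftrightarrow> X \<subseteq> topspace K \<and> finitary_closed box_reps X"

definition region :: "'a set \<Rightarrow> 'a set"
  where "region X = (\<Union>x\<in>X. cell x)"

lemma separators_on_continuous:
  "f \<in> separators_on X \<Longrightarrow> continuous_map K euclideanreal f"
  unfolding separators_on_def using separators(2) by blast

lemma separators_on_mono: "X \<subseteq> X' \<Longrightarrow> separators_on X \<subseteq> separators_on X'"
  unfolding separators_on_def by blast

lemma region_mono: "X \<subseteq> X' \<Longrightarrow> region X \<subseteq> region X'"
  unfolding region_def by blast

lemma closedin_region: "closedin K (region X)"
  unfolding region_def by (rule closedin_UN_cell)

lemma separators_on_region:
  assumes "X \<subseteq> topspace K" "p \<in> region X" "q \<in> region X" "\<forall>f\<in>separators_on X. f p = f q"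
  shows "p = q"
proof (rule ccontr)
  assume "p \<noteq> q"
  obtain x x' where x: "x \<in> X" "p \<in> cell x" "x' \<in> X" "q \<in> cell x'"
    using assms unfolding region_def by blast
  then have "x \<in> topspace K" "x' \<in> topspace K"
    using assms(1) by auto
  from separators(3) [OF this x(2,4) \<open>p \<noteq> q\<close>] obtain f where "f \<in> separators x x'" "f p \<noteq> f q"
    by blast
  moreover have "separators x x' \<subseteq> separators_on X"
    unfolding separators_on_def using x \<open>x \<in> topspace K\<close> \<open>x' \<in> topspace K\<close> by blast
  ultimately show False
    using assms(4) by blast
qed

lemma box_Cons: "box ((f, a, b) # l) = {y \<in> topspace K. f y \<in> {a..b}} \<inter> box l"
  by (auto simp: box_def)

lemma box_append: "box (l @ l') = box l \<inter> box l'"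
  by (simp add: box_def ball_Un) blast

lemma closedin_box:
  assumes "l \<in> lists (separators_on X \<times> \<rat> \<times> \<rat>)"
  shows "closedin K (box l)"
  using assms
proof (induction l)
  case Nil
  then show ?case by (simp add: box_def)
next
  case (Cons z l)
  obtain f a b where z: "z = (f, a, b)" by (cases z)
  have "closedin K {y \<in> topspace K. f y \<in> {a..b}}"
    using Cons.hyps
    by (intro closedin_continuous_map_preimage [OF separators_on_continuous [of f X]]) (auto simp: z)
  then show ?case
    unfolding z box_Cons using Cons by (intro closedin_Int) auto
qed

lemma countable_box_reps:
  assumes "finite F"
  shows "countable (box_reps F)"
proof -
  have "countable (separators_on F)"
    unfolding separators_on_def using assms separators(1) by (intro countable_UN) (auto simp: countable_finite)
  then have "countable (lists (separators_on F \<times> \<rat> \<times> \<rat>))"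
    by (intro countable_lists countable_SIGMA countable_rat)
  moreover have "countable (reps (box l))" if "l \<in> lists (separators_on F \<times> \<rat> \<times> \<rat>)" for l
    using reps(1) [OF closedin_box [OF that]] by (rule countable_finite)
  ultimately show ?thesis
    unfolding box_reps_def by (rule countable_UN)
qed

lemma box_reps_subset: "box_reps F \<subseteq> topspace K"
  unfolding box_reps_def using reps(2) closedin_box by blast

text \<open>A box mentions finitely many functions, each attached to two points of \<open>X\<close>,
  so it is a box over a finite subset of \<open>X\<close>.\<close>

lemma reps_box_subset_model:
  assumes X: "model X" and l: "l \<in> lists (separators_on X \<times> \<rat> \<times> \<rat>)"
  shows "reps (box l) \<subseteq> X"
proof -
  have "\<exists>F. finite F \<and> F \<subseteq> X \<and> l \<in> lists (separators_on F \<times> \<rat> \<times> \<rat>)"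
    using l
  proof (induction l)
    case Nil
    then show ?case by (intro exI [of _ "{}"]) simp
  next
    case (Cons z l)
    then obtain F where F: "finite F" "F \<subseteq> X" "l \<in> lists (separators_on F \<times> \<rat> \<times> \<rat>)"
      by auto
    obtain f a b where z: "z = (f, a, b)" "f \<in> separators_on X" "a \<in> \<rat>" "b \<in> \<rat>"
      using Cons.hyps by (cases z) auto
    then obtain x x' where x: "x \<in> X \<inter> topspace K" "x' \<in> X \<inter> topspace K" "f \<in> separators x x'"
      unfolding separators_on_def by blast
    have "f \<in> separators_on (insert x (insert x' F))"
      using x unfolding separators_on_def by blast
    moreover have "separators_on F \<subseteq> separators_on (insert x (insert x' F))"
      by (intro separators_on_mono) auto
    then have "l \<in> lists (separators_on (insert x (insert x' F)) \<times> \<rat> \<times> \<rat>)"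
      using F(3) lists_mono [of "separators_on F \<times> \<rat> \<times> \<rat>"] by blast
    ultimately have "z # l \<in> lists (separators_on (insert x (insert x' F)) \<times> \<rat> \<times> \<rat>)"
      using z by simp
    then show ?case
      using F x by (intro exI [of _ "insert x (insert x' F)"]) auto
  qed
  then obtain F where F: "finite F \<and> F \<subseteq> X" "l \<in> lists (separators_on F \<times> \<rat> \<times> \<rat>)"
    by blast
  have "box_reps F \<subseteq> X"
    using X F(1) unfolding model_def finitary_closed_def by blast
  then show ?thesis
    using F(2) unfolding box_reps_def by blast
qed

end

section \<open>Retractions onto unions of cells\<close>

lemma ex_Rats_interval_excluding:
  fixes u v :: real
  assumes "u \<noteq> v"
  obtains a b where "a \<in> \<rat>" "b \<in> \<rat>" "a \<le> v" "v \<le> b" "u \<notin> {a..b}"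
proof -
  obtain a where a: "a \<in> \<rat>" "v - \<bar>u - v\<bar> < a" "a < v"
    using Rats_dense_in_real [of "v - \<bar>u - v\<bar>" v] assms by auto
  obtain b where b: "b \<in> \<rat>" "v < b" "b < v + \<bar>u - v\<bar>"
    using Rats_dense_in_real [of v "v + \<bar>u - v\<bar>"] assms by auto
  have "u \<notin> {a..b}" using a b by (auto simp: abs_real_def split: if_splits)
  with a b that show thesis by force
qed

context closure_preserving_metrizable_cover
begin

text \<open>Each point of the compact set \<open>E\<close> violates a single rational condition that
  holds at \<open>y\<close>. A finite subcover by these violations turns into a list of
  conditions.\<close>

lemma box_avoiding_compact:
  assumes y: "y \<in> topspace K" and E: "closedin K E"
    and ne: "\<And>e. e \<in> E \<Longrightarrow> \<exists>f\<in>separators_on X. f e \<noteq> f y"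
  shows "\<exists>l\<in>lists (separators_on X \<times> \<rat> \<times> \<rat>). y \<in> box l \<and> box l \<inter> E = {}"
proof -
  let ?L = "{z \<in> separators_on X \<times> \<rat> \<times> \<rat>. y \<in> box [z]}"
  have L: "openin K (topspace K - box [z])" if "z \<in> ?L" for z
    using that by (intro openin_diff openin_topspace closedin_box) auto
  have "E \<subseteq> (\<Union>z\<in>?L. topspace K - box [z])"
  proof
    fix e assume e: "e \<in> E"
    then obtain f where f: "f \<in> separators_on X" "f e \<noteq> f y"
      using ne by blast
    obtain a b where ab: "a \<in> \<rat>" "b \<in> \<rat>" "a \<le> f y" "f y \<le> b" "f e \<notin> {a..b}"
      by (rule ex_Rats_interval_excluding [OF f(2)])
    have "(f, a, b) \<in> ?L"
      using f ab y by (simp add: box_def)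
    moreover have "e \<in> topspace K - box [(f, a, b)]"
      using ab e closedin_subset [OF E] by (auto simp: box_def)
    ultimately show "e \<in> (\<Union>z\<in>?L. topspace K - box [z])" by blast
  qed
  moreover have "compactin K E"
    using compact E by (rule closedin_compact_space)
  moreover have "openin K U" if "U \<in> (\<lambda>z. topspace K - box [z]) ` ?L" for U
    using that L by blast
  ultimately have "\<exists>\<F>. finite \<F> \<and> \<F> \<subseteq> (\<lambda>z. topspace K - box [z]) ` ?L \<and> E \<subseteq> \<Union>\<F>"
    by (intro compactinD)
  then obtain \<F> where \<F>: "finite \<F>" "\<F> \<subseteq> (\<lambda>z. topspace K - box [z]) ` ?L" "E \<subseteq> \<Union>\<F>"
    by blast
  obtain Z where Z: "finite Z" "Z \<subseteq> ?L" "\<F> = (\<lambda>z. topspace K - box [z]) ` Z"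
    using finite_subset_image [OF \<F>(1,2)] by blast
  obtain l where l: "set l = Z"
    using finite_list [OF Z(1)] by blast
  have box: "w \<in> box l \<longleftrightarrow> w \<in> topspace K \<and> (\<forall>z\<in>Z. w \<in> box [z])" for w
    unfolding box_def l [symmetric] by auto
  show ?thesis
  proof (intro bexI conjI)
    show "l \<in> lists (separators_on X \<times> \<rat> \<times> \<rat>)"
      using Z(2) l by (auto simp: lists_eq_set)
    show "y \<in> box l"
      using box y Z(2) by blast
    show "box l \<inter> E = {}"
      using \<F>(3) box unfolding Z(3) by blast
  qed
qed

text \<open>Otherwise the fibre of \<open>y\<close> is approximated by boxes \<open>B n\<close> in such a way that \<open>B (Suc n)\<close>
  avoids the cells covering \<open>minimal (B n)\<close>, which belong to the region.\<close>

lemma ex_region_same_separators: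
  assumes X: "model X" and y: "y \<in> topspace K"
  shows "\<exists>z\<in>region X. \<forall>f\<in>separators_on X. f z = f y"
proof (rule ccontr)
  assume neg: "\<not> ?thesis"
  have "\<exists>l. \<forall>n. (l n \<in> lists (separators_on X \<times> \<rat> \<times> \<rat>) \<and> y \<in> box (l n)) \<and>
      (box (l (Suc n)) \<subseteq> box (l n) \<and> box (l (Suc n)) \<inter> minimal (box (l n)) = {})"
  proof (rule dependent_nat_choice)
    show "\<exists>l. l \<in> lists (separators_on X \<times> \<rat> \<times> \<rat>) \<and> y \<in> box l"
      using y by (intro exI [of _ "[]"]) (simp add: box_def)
  next
    fix l and n :: nat
    assume l: "l \<in> lists (separators_on X \<times> \<rat> \<times> \<rat>) \<and> y \<in> box l"
    let ?E = "\<Union>x\<in>reps (box l). cell x"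
    have "?E \<subseteq> region X"
      using reps_box_subset_model [OF X] l unfolding region_def by blast
    then have "\<exists>f\<in>separators_on X. f e \<noteq> f y" if "e \<in> ?E" for e
      using neg that by blast
    then obtain l' where l': "l' \<in> lists (separators_on X \<times> \<rat> \<times> \<rat>)" "y \<in> box l'" "box l' \<inter> ?E = {}"
      using box_avoiding_compact [OF y closedin_UN_cell] by meson
    have "minimal (box l) \<subseteq> ?E"
      using reps(3) [OF closedin_box] l by blast
    then show "\<exists>l'. (l' \<in> lists (separators_on X \<times> \<rat> \<times> \<rat>) \<and> y \<in> box l') \<and>
        (box l' \<subseteq> box l \<and> box l' \<inter> minimal (box l) = {})"
      using l l' by (intro exI [of _ "l @ l'"]) (auto simp: box_append)
  qed
  then obtain l where l: "\<forall>n. (l n \<in> lists (separators_on X \<times> \<rat> \<times> \<rat>) \<and> y \<in> box (l n)) \<and>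
      (box (l (Suc n)) \<subseteq> box (l n) \<and> box (l (Suc n)) \<inter> minimal (box (l n)) = {})"
    by blast
  show False
  proof (rule no_sequence_avoiding_minimal)
    show "closedin K (box (l n))" for n
      using l by (intro closedin_box) blast
    show "decseq (\<lambda>n. box (l n))"
      unfolding decseq_Suc_iff using l by blast
    show "box (l n) \<noteq> {}" for n
      using l by blast
    show "box (l (Suc n)) \<inter> minimal (box (l n)) = {}" for n
      using l by blast
  qed
qed

text \<open>For a model the point is unique by \<open>separators_on_region\<close>. The map is
  evaluation at the attached functions followed by the inverse of its restriction to the region; in
  particular it fixes the region pointwise.\<close>

definition retract :: "'a set \<Rightarrow> 'a \<Rightarrow> 'a"
  where "retract X y = (SOME z. z \<in> region X \<and> (\<forall>f\<in>separators_on X. f z = f y))"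

lemma retract:
  assumes "model X" "y \<in> topspace K"
  shows "retract X y \<in> region X" "\<forall>f\<in>separators_on X. f (retract X y) = f y"
proof -
  have "retract X y \<in> region X \<and> (\<forall>f\<in>separators_on X. f (retract X y) = f y)"
    unfolding retract_def
    by (rule someI_ex) (use ex_region_same_separators [OF assms] in \<open>simp add: Bex_def\<close>)
  then show "retract X y \<in> region X" "\<forall>f\<in>separators_on X. f (retract X y) = f y" by auto
qed

lemma retract_eqI:
  assumes "model X" "y \<in> topspace K" "z \<in> region X" "\<forall>f\<in>separators_on X. f z = f y"
  shows "retract X y = z"
proof (rule separators_on_region [of X])
  show "X \<subseteq> topspace K" using assms by (simp add: model_def)
qed (use retract [OF assms(1,2)] assms in auto)

text \<open>Continuity of the retraction: its preimage of \<open>C\<close> is the preimage under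
  evaluation of the image of \<open>C\<close> under evaluation, and that image is compact in a
  Hausdorff space.\<close>

lemma closedin_retract_preimage:
  assumes X: "model X" and C: "closedin K C" "C \<subseteq> region X"
  shows "closedin K {y \<in> topspace K. retract X y \<in> C}"
proof -
  let ?\<Phi> = "separators_on X"
  define e where "e y = (\<lambda>f\<in>?\<Phi>. f y)" for y
  have e: "continuous_map K (powertop_real ?\<Phi>) e"
    unfolding continuous_map_componentwise using separators_on_continuous by (auto simp: e_def)
  have "compactin (powertop_real ?\<Phi>) (e ` C)"
    using closedin_compact_space [OF compact C(1)] e by (rule image_compactin)
  then have "closedin (powertop_real ?\<Phi>) (e ` C)"
    by (intro compactin_imp_closedin) (auto simp: Hausdorff_space_product_topology)
  then have "closedin K {y \<in> topspace K. e y \<in> e ` C}"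
    by (rule closedin_continuous_map_preimage [OF e])
  moreover have "retract X y \<in> C \<longleftrightarrow> e y \<in> e ` C" if y: "y \<in> topspace K" for y
  proof
    assume "retract X y \<in> C"
    moreover have "e (retract X y) = e y"
      using retract(2) [OF X y] by (auto simp: e_def fun_eq_iff)
    ultimately show "e y \<in> e ` C" by (metis imageI)
  next
    assume "e y \<in> e ` C"
    then obtain c where c: "c \<in> C" "e c = e y" by force
    then have "\<forall>f\<in>?\<Phi>. f c = f y"
      by (metis e_def restrict_apply')
    with c C(2) have "retract X y = c"
      by (intro retract_eqI [OF X y]) auto
    with c show "retract X y \<in> C" by simp
  qed
  ultimately show ?thesis by (simp cong: conj_cong)
qed

lemma openin_retract_preimage:
  assumes X: "model X" and V: "openin (subtopology K (region X)) V"
  shows "openin K {y \<in> topspace K. retract X y \<in> V}"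
proof -
  have "closedin (subtopology K (region X)) (region X - V)"
    using V closedin_subset [OF closedin_region [of X]]
    by (metis closedin_diff closedin_topspace topspace_subtopology_subset)
  then have "closedin K (region X - V)"
    using closedin_region closedin_trans_full by blast
  then have "closedin K {y \<in> topspace K. retract X y \<in> region X - V}"
    by (rule closedin_retract_preimage [OF X]) auto
  moreover have "{y \<in> topspace K. retract X y \<in> V} =
      topspace K - {y \<in> topspace K. retract X y \<in> region X - V}"
    using retract(1) [OF X] by auto
  ultimately show ?thesis by auto
qed

lemma model_Union_chain:
  assumes "\<And>b. b \<in> B \<Longrightarrow> model (Y b)" "B \<noteq> {}"
    and chain: "\<And>a b. a \<in> B \<Longrightarrow> b \<in> B \<Longrightarrow> Y a \<subseteq> Y b \<or> Y b \<subseteq> Y a"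
  shows "model (\<Union>b\<in>B. Y b)"
proof -
  have "finitary_closed box_reps (\<Union>(Y ` B))"
  proof (rule finitary_closed_Union_directed)
    show "finitary_closed box_reps X" if "X \<in> Y ` B" for X
      using assms(1) that by (auto simp: model_def)
    show "\<exists>C\<in>Y ` B. P \<union> Q \<subseteq> C" if PQ: "P \<in> Y ` B" "Q \<in> Y ` B" for P Q
    proof -
      obtain a b where ab: "P = Y a" "Q = Y b" "a \<in> B" "b \<in> B" using PQ by blast
      then have "P \<union> Q = P \<or> P \<union> Q = Q"
        using chain [OF ab(3,4)] by blast
      then show ?thesis using PQ by (metis order_refl)
    qed
  qed (use \<open>B \<noteq> {}\<close> in auto)
  moreover have "Y b \<subseteq> topspace K" if "b \<in> B" for b
    using assms(1) [OF that] by (simp add: model_def)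
  ultimately show ?thesis
    by (auto simp: model_def)
qed

text \<open>Along an infinite increasing sequence of stages at which the retraction of \<open>y\<close> is new, the
  retraction of \<open>y\<close> to the union of the stages would already belong to one of them.\<close>

lemma finite_new_stages:
  assumes r: "well_order_on I r" and Y: "\<And>a. a \<in> I \<Longrightarrow> model (Y a)"
    and mono: "\<And>a b. (a, b) \<in> r \<Longrightarrow> Y a \<subseteq> Y b" and y: "y \<in> topspace K"
  shows "finite {a \<in> I. retract (Y a) y \<notin> (\<Union>b\<in>underS r a. region (Y b))}"
proof -
  define B where "B = {a \<in> I. retract (Y a) y \<notin> (\<Union>b\<in>underS r a. region (Y b))}"
  have total: "(a, b) \<in> r \<or> (b, a) \<in> r" if "a \<in> I" "b \<in> I" for a b
    using r that unfolding well_order_on_def linear_order_on_def partial_order_on_def preorder_on_def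
      total_on_def refl_on_def by metis
  \<comment> \<open>The assumption says that \<open>S\<close> has order type at most
    \<open>\<omega>\<close>. The claim is used inside the well-founded induction, for the new stages
    before a given one, and then once more for all of \<open>B\<close>.\<close>
  have key: "finite S" if S: "S \<subseteq> B" and down: "\<And>b. b \<in> S \<Longrightarrow> finite (B \<inter> underS r b)" for S
  proof (rule ccontr)
    assume inf: "infinite S"
    define Z where "Z = (\<Union>b\<in>S. Y b)"
    have SI: "S \<subseteq> I" using S by (auto simp: B_def)
    have Z: "model Z"
      unfolding Z_def
    proof (rule model_Union_chain)
      show "model (Y b)" if "b \<in> S" for b using Y SI that by blast
      show "S \<noteq> {}" using inf by auto
      show "Y a \<subseteq> Y b \<or> Y b \<subseteq> Y a" if "a \<in> S" "b \<in> S" for a b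
        using total [of a b] mono [of a b] mono [of b a] SI that by blast
    qed
    obtain b where b: "b \<in> S" "retract Z y \<in> region (Y b)"
      using retract(1) [OF Z y] by (auto simp: Z_def region_def)
    have "finite (insert b (B \<inter> underS r b))"
      using down b by simp
    \<comment> \<open>Only finitely many new stages precede \<open>b\<close>, so the infinite set
      \<open>S\<close> has a stage \<open>c\<close> after \<open>b\<close>. The point
      \<open>retract Z y\<close> agrees with \<open>y\<close> on all functions of
      \<open>Y c\<close>, so it is also the retraction to \<open>Y c\<close>; but it already lies in
      the earlier region of \<open>Y b\<close>.\<close>
    then have "\<not> S \<subseteq> insert b (B \<inter> underS r b)"
      using inf finite_subset by blast
    then obtain c where c: "c \<in> S" "c \<noteq> b" "c \<notin> underS r b"
      using S by blast
    then have bc: "(b, c) \<in> r"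
      using total [of b c] SI b by (auto simp: underS_def)
    have "Y c \<subseteq> Z" using c by (auto simp: Z_def)
    then have "\<forall>f\<in>separators_on (Y c). f (retract Z y) = f y"
      using retract(2) [OF Z y] separators_on_mono by blast
    moreover have "retract Z y \<in> region (Y c)"
      using b(2) region_mono [OF mono [OF bc]] by blast
    ultimately have "retract (Y c) y = retract Z y"
      using Y SI c(1) by (intro retract_eqI [OF _ y]) auto
    moreover have "b \<in> underS r c"
      using bc c by (auto simp: underS_def)
    ultimately have "retract (Y c) y \<in> (\<Union>b\<in>underS r c. region (Y b))"
      using b(2) by auto
    with c S show False by (auto simp: B_def)
  qed
  have wf: "wf (r - Id)"
    using r by (simp add: well_order_on_def)
  have stages: "finite (B \<inter> underS r a)" for a
  proof (induction a rule: wf_induct_rule [OF wf])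
    case (1 a)
    show ?case
    proof (rule key)
      show "finite (B \<inter> underS r b)" if "b \<in> B \<inter> underS r a" for b
        using that by (intro 1) (auto simp: underS_def)
    qed blast
  qed
  have "finite B"
    by (rule key) (auto simp: stages)
  then show ?thesis
    by (simp add: B_def)
qed

end

section \<open>Hereditary metacompactness\<close>

lemma point_finite_image:
  assumes "\<And>x. finite {i \<in> I. x \<in> A i}"
  shows "point_finite (A ` I) (\<lambda>V. V)"
  unfolding point_finite_def
proof
  fix x
  have "{V \<in> A ` I. x \<in> V} = A ` {i \<in> I. x \<in> A i}" by blast
  then show "finite {V \<in> A ` I. x \<in> V}"
    using assms [of x] by simp
qed

lemma point_finite_cozero_shrinking:
  fixes f :: "nat \<Rightarrow> 'a \<Rightarrow> real"
  assumes f: "\<And>n. continuous_map K euclideanreal (f n)"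
  shows "\<exists>W. (\<forall>n. openin K (W n)) \<and> (\<forall>n. W n \<subseteq> {x \<in> topspace K. 0 < f n x}) \<and>
    (\<Union>n. W n) = (\<Union>n. {x \<in> topspace K. 0 < f n x}) \<and> (\<forall>x. finite {n. x \<in> W n})"
proof -
  \<comment> \<open>A point with \<open>0 < f m x\<close> leaves \<open>W n\<close> as soon as \<open>1 / Suc n \<le> f m x\<close>.\<close>
  define W where "W n = {x \<in> topspace K. 0 < f n x} \<inter>
    (\<Inter>m\<in>{..<n}. {x \<in> topspace K. f m x < 1 / real (Suc n)})" for n
  show ?thesis
  proof (intro exI [of _ W] conjI allI)
    show "openin K (W n)" for n
    proof (cases "n = 0")
      case True
      then show ?thesis
        using openin_continuous_map_less(1) [OF f] by (simp add: W_def)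
    next
      case False
      then have "openin K (\<Inter>m\<in>{..<n}. {x \<in> topspace K. f m x < 1 / real (Suc n)})"
        by (intro openin_INT2 openin_continuous_map_less f) auto
      then show ?thesis
        unfolding W_def by (intro openin_Int openin_continuous_map_less f)
    qed
    show "W n \<subseteq> {x \<in> topspace K. 0 < f n x}" for n
      by (auto simp: W_def)
    show "(\<Union>n. W n) = (\<Union>n. {x \<in> topspace K. 0 < f n x})"
    proof (intro equalityI subsetI)
      fix x assume "x \<in> (\<Union>n. {x \<in> topspace K. 0 < f n x})"
      then have x: "x \<in> topspace K" "\<exists>n. 0 < f n x" by auto
      \<comment> \<open>At the least such index all earlier functions are at most 0 at
        \<open>x\<close>, so the shrinking does not lose \<open>x\<close>.\<close>
      define n where "n = (LEAST n. 0 < f n x)"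
      have "0 < f n x"
        unfolding n_def using x(2) by (rule LeastI_ex)
      moreover have "f m x < 1 / real (Suc n)" if "m < n" for m
      proof -
        have "\<not> 0 < f m x"
          using not_less_Least that unfolding n_def by blast
        then show ?thesis
          by (simp add: order_le_less_trans [of _ 0])
      qed
      ultimately have "x \<in> W n"
        using x(1) by (simp add: W_def)
      then show "x \<in> (\<Union>n. W n)" by blast
    qed (auto simp: W_def)
    show "finite {n. x \<in> W n}" for x
    proof (cases "\<exists>n. x \<in> W n")
      case True
      then obtain n where n: "0 < f n x" by (auto simp: W_def)
      obtain N where N: "1 / real (Suc N) < f n x"
        using nat_approx_posE [OF n] by blast
      have "m \<le> max n N" if "x \<in> W m" for m
      proof (rule ccontr)
        assume "\<not> m \<le> max n N"
        then have "f n x < 1 / real (Suc m)" "N < m"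
          using that by (auto simp: W_def)
        moreover have "1 / real (Suc m) \<le> 1 / real (Suc N)"
          using \<open>N < m\<close> by (simp add: divide_simps)
        ultimately show False using N by linarith
      qed
      then have "{n. x \<in> W n} \<subseteq> {..max n N}" by blast
      then show ?thesis by (rule finite_subset) simp
    qed simp
  qed
qed

text \<open>The open family may cover only a part of \<open>Z\<close>, so the property concerns
  every relatively open part at once. For the whole space it reaches all subspaces, because an open
  cover of a subspace consists of traces of open sets.\<close>

definition point_finitely_refinable :: "'a topology \<Rightarrow> 'a set \<Rightarrow> bool"
  where "point_finitely_refinable K Z \<longleftrightarrow>
    (\<forall>\<G>. (\<forall>G\<in>\<G>. openin K G) \<longrightarrow>
      (\<exists>\<V>. (\<forall>V\<in>\<V>. openin (subtopology K Z) V \<and> (\<exists>G\<in>\<G>. V \<subseteq> G)) \<and>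
        \<Union>\<V> = Z \<inter> \<Union>\<G> \<and> point_finite \<V> (\<lambda>V. V)))"

lemma point_finitely_refinable_imp_hereditarily_metacompact:
  assumes "point_finitely_refinable K (topspace K)"
  shows "hereditarily_metacompact K"
  unfolding hereditarily_metacompact_def metacompact_space_def
proof (intro allI impI)
  fix S \<C>
  assume S: "S \<subseteq> topspace K"
    and \<C>: "(\<forall>C\<in>\<C>. openin (subtopology K S) C) \<and> \<Union>\<C> = topspace (subtopology K S)"
  define \<G> where "\<G> = {G. openin K G \<and> G \<inter> S \<in> \<C>}"
  have top: "topspace (subtopology K S) = S"
    using S by auto
  obtain \<V> where \<V>: "\<forall>V\<in>\<V>. openin K V \<and> (\<exists>G\<in>\<G>. V \<subseteq> G)"
    "\<Union>\<V> = topspace K \<inter> \<Union>\<G>" "point_finite \<V> (\<lambda>V. V)"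
    using assms [unfolded point_finitely_refinable_def, rule_format, of \<G>] by (auto simp: \<G>_def)
  have SG: "S \<subseteq> \<Union>\<G>"
  proof
    fix x assume "x \<in> S"
    then obtain C where C: "C \<in> \<C>" "x \<in> C" using \<C> top by auto
    then obtain G where "openin K G" "C = G \<inter> S"
      using \<C> unfolding openin_subtopology by blast
    then show "x \<in> \<Union>\<G>"
      using C by (auto simp: \<G>_def)
  qed
  show "\<exists>\<W>. (\<forall>V\<in>\<W>. openin (subtopology K S) V \<and> (\<exists>C\<in>\<C>. V \<subseteq> C)) \<and>
      \<Union>\<W> = topspace (subtopology K S) \<and> point_finite \<W> (\<lambda>V. V)"
  proof (intro exI [of _ "(\<lambda>V. S \<inter> V) ` \<V>"] conjI ballI)
    fix W assume "W \<in> (\<lambda>V. S \<inter> V) ` \<V>"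
    then obtain V where V: "V \<in> \<V>" "W = S \<inter> V" by blast
    then obtain G where G: "G \<in> \<G>" "V \<subseteq> G" "openin K V"
      using \<V>(1) by blast
    show "openin (subtopology K S) W"
      unfolding V(2) by (rule openin_subtopology_Int2) (rule G)
    show "\<exists>C\<in>\<C>. W \<subseteq> C"
      using G V by (intro bexI [of _ "G \<inter> S"]) (auto simp: \<G>_def)
  next
    have "\<Union>((\<lambda>V. S \<inter> V) ` \<V>) = S \<inter> \<Union>\<V>" by blast
    then show "\<Union>((\<lambda>V. S \<inter> V) ` \<V>) = topspace (subtopology K S)"
      using SG S unfolding top \<V>(2) by auto
    have "finite {V \<in> \<V>. x \<in> S \<inter> V}" for x
      by (rule finite_subset [of _ "{V \<in> \<V>. x \<in> V}"]) (use \<V>(3) in \<open>auto simp: point_finite_def\<close>)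
    then show "point_finite ((\<lambda>V. S \<inter> V) ` \<V>) (\<lambda>V. V)"
      by (rule point_finite_image)
  qed
qed

lemma hereditarily_Lindelof_imp_point_finitely_refinable:
  assumes K: "compact_space K" "Hausdorff_space K" and Z: "Z \<subseteq> topspace K"
    and L: "\<And>S. S \<subseteq> Z \<Longrightarrow> Lindelof_space (subtopology K S)"
  shows "point_finitely_refinable K Z"
  unfolding point_finitely_refinable_def
proof (intro allI impI)
  fix \<G> assume \<G>: "\<forall>G\<in>\<G>. openin K G"
  define \<C> where "\<C> = {C. cozero_in K C \<and> (\<exists>G\<in>\<G>. C \<subseteq> G)}"
  have "Z \<inter> \<Union>\<G> \<subseteq> \<Union>\<C>"
  proof
    fix p assume "p \<in> Z \<inter> \<Union>\<G>"
    then obtain G where G: "p \<in> G" "G \<in> \<G>" by blast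
    then have "openin K G" using \<G> by blast
    from compact_Hausdorff_cozero_nbhd [OF K this G(1)]
    obtain C where "cozero_in K C" "p \<in> C" "C \<subseteq> G" .
    then show "p \<in> \<Union>\<C>" using G by (auto simp: \<C>_def)
  qed
  moreover have "openin K C" if "C \<in> \<C>" for C
    using that cozero_in_imp_openin by (auto simp: \<C>_def)
  moreover have "Z \<inter> \<Union>\<G> \<subseteq> topspace K" using Z by blast
  ultimately obtain \<D> where \<D>: "countable \<D>" "\<D> \<subseteq> \<C>" "Z \<inter> \<Union>\<G> \<subseteq> \<Union>\<D>"
    using L [of "Z \<inter> \<Union>\<G>", unfolded Lindelof_space_subtopology, rule_format, of \<C>]
    by (auto simp: inf.absorb2)
  \<comment> \<open>The empty set is added so that an enumeration by \<open>nat\<close> exists even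
    if \<open>\<D>\<close> is empty. Indices with empty \<open>W n\<close> are discarded below,
    since the added set need not lie inside a member of \<open>\<G>\<close>.\<close>
  define D where "D = from_nat_into (insert {} \<D>)"
  have D: "range D = insert {} \<D>"
    unfolding D_def using \<D>(1) by (intro range_from_nat_into) auto
  have "\<forall>n. \<exists>f. continuous_map K euclideanreal f \<and> D n = {x \<in> topspace K. 0 < f x}"
  proof
    fix n
    have "cozero_in K {}"
      unfolding cozero_in_def by (intro exI [of _ "\<lambda>x. 0"]) auto
    moreover have "D n \<in> insert {} \<D>"
      unfolding D [symmetric] by (rule rangeI)
    moreover have "\<forall>C\<in>\<D>. cozero_in K C"
      using \<D>(2) by (auto simp: \<C>_def)
    ultimately have "cozero_in K (D n)" by auto
    then obtain f where "continuous_map K euclideanreal f" "D n = {x \<in> topspace K. 0 < f x}"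
      by (rule cozero_inE)
    then show "\<exists>f. continuous_map K euclideanreal f \<and> D n = {x \<in> topspace K. 0 < f x}"
      by (intro exI conjI)
  qed
  then obtain f where f: "\<forall>n. continuous_map K euclideanreal (f n) \<and> D n = {x \<in> topspace K. 0 < f n x}"
    by metis
  have fc: "continuous_map K euclideanreal (f n)" for n using f by blast
  from point_finite_cozero_shrinking [of K f, OF fc]
  obtain W where W4: "(\<forall>n. openin K (W n)) \<and> (\<forall>n. W n \<subseteq> {x \<in> topspace K. 0 < f n x}) \<and>
    (\<Union>n. W n) = (\<Union>n. {x \<in> topspace K. 0 < f n x}) \<and> (\<forall>x. finite {n. x \<in> W n})" ..
  note W = W4 [THEN conjunct1] W4 [THEN conjunct2, THEN conjunct1]
    W4 [THEN conjunct2, THEN conjunct2, THEN conjunct1] W4 [THEN conjunct2, THEN conjunct2, THEN conjunct2]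
  have Wo: "openin K (W n)" for n using W(1) by blast
  have WD: "W n \<subseteq> D n" for n
    using spec [OF W(2), of n] spec [OF f, of n] by simp
  have UW: "(\<Union>n. W n) = \<Union>\<D>"
  proof -
    have "(\<Union>n. W n) = (\<Union>n. D n)"
      unfolding W(3) using f by (intro SUP_cong) auto
    then show ?thesis using D by simp
  qed
  define I where "I = {n. W n \<noteq> {}}"
  show "\<exists>\<V>. (\<forall>V\<in>\<V>. openin (subtopology K Z) V \<and> (\<exists>G\<in>\<G>. V \<subseteq> G)) \<and>
        \<Union>\<V> = Z \<inter> \<Union>\<G> \<and> point_finite \<V> (\<lambda>V. V)"
  proof (intro exI [of _ "(\<lambda>n. Z \<inter> W n) ` I"] conjI ballI)
    fix V assume "V \<in> (\<lambda>n. Z \<inter> W n) ` I"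
    then obtain n where n: "V = Z \<inter> W n" "W n \<noteq> {}" by (auto simp: I_def)
    show "openin (subtopology K Z) V"
      unfolding n(1) by (rule openin_subtopology_Int2) (rule Wo)
    have "D n \<in> \<C>"
      using n(2) WD [of n] D \<D>(2) by blast
    then show "\<exists>G\<in>\<G>. V \<subseteq> G"
      using n(1) WD [of n] by (auto simp: \<C>_def)
  next
    have "\<Union>\<D> \<subseteq> \<Union>\<G>"
      using \<D>(2) by (auto simp: \<C>_def)
    moreover have "\<Union>((\<lambda>n. Z \<inter> W n) ` I) = Z \<inter> (\<Union>n. W n)"
      by (auto simp: I_def)
    ultimately show "\<Union>((\<lambda>n. Z \<inter> W n) ` I) = Z \<inter> \<Union>\<G>"
      using \<D>(3) UW by auto
    have "finite {n \<in> I. x \<in> Z \<inter> W n}" for x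
      by (rule finite_subset [OF _ spec [OF W(4), of x]]) auto
    then show "point_finite ((\<lambda>n. Z \<inter> W n) ` I) (\<lambda>V. V)"
      by (rule point_finite_image)
  qed
qed

section \<open>Refinements for models, by induction along chains\<close>

context closure_preserving_metrizable_cover
begin

text \<open>Every subset of the region is a countable union of second countable pieces of cells,
  hence Lindelof.\<close>

lemma point_finitely_refinable_countable_model:
  assumes X: "X \<subseteq> topspace K" "countable X"
  shows "point_finitely_refinable K (region X)"
proof (rule hereditarily_Lindelof_imp_point_finitely_refinable [OF compact Hausdorff])
  show "region X \<subseteq> topspace K"
    using closedin_subset [OF closedin_region] .
  fix S assume S: "S \<subseteq> region X"
  have "Lindelof_space (subtopology K (\<Union>((\<lambda>x. S \<inter> cell x) ` X)))"
  proof (rule Lindelof_space_Union)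
    show "countable ((\<lambda>x. S \<inter> cell x) ` X)" using X by simp
    fix U assume "U \<in> (\<lambda>x. S \<inter> cell x) ` X"
    then obtain x where x: "x \<in> X" "U = cell x \<inter> S" by blast
    then have "second_countable (subtopology (subtopology K (cell x)) S)"
      using X by (intro second_countable_subtopology second_countable_cell) auto
    then show "Lindelof_space (subtopology K U)"
      unfolding x(2) subtopology_subtopology by (rule second_countable_imp_Lindelof_space)
  qed
  moreover have "\<Union>((\<lambda>x. S \<inter> cell x) ` X) = S"
    using S by (auto simp: region_def)
  ultimately show "Lindelof_space (subtopology K S)" by simp
qed

text \<open>A point of the region is covered at the first stage \<open>a\<close> whose region
  contains it: it lies outside \<open>old a\<close> and is fixed by the retraction. Conversely,
  \<open>y \<in> W (a, V)\<close> puts \<open>retract (Y a) y\<close> into \<open>V\<close> and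
  hence outside \<open>old a\<close>, so \<open>a\<close> is one of the finitely many new stages of
  \<open>y\<close>; at each of them finitely many \<open>V\<close> contain the retracted
  point.\<close>

lemma point_finitely_refinable_chain:
  assumes X: "model X" and r: "well_order_on X r" and Y: "\<And>a. a \<in> X \<Longrightarrow> model (Y a)"
    and ref: "\<And>a. a \<in> X \<Longrightarrow> point_finitely_refinable K (region (Y a))"
    and mono: "\<And>a b. (a, b) \<in> r \<Longrightarrow> Y a \<subseteq> Y b" and XY: "X = (\<Union>a\<in>X. Y a)"
  shows "point_finitely_refinable K (region X)"
  unfolding point_finitely_refinable_def
proof (intro allI impI)
  fix \<G> assume \<G>: "\<forall>G\<in>\<G>. openin K G"
  define old where "old a = (\<Union>b\<in>underS r a. region (Y b))" for a
  \<comment> \<open>Also at a limit stage, \<open>old a\<close> is a union of cells and therefore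
    closed; this makes the sets \<open>G - old a\<close> open.\<close>
  have "closedin K (old a)" for a
  proof -
    have "old a = (\<Union>x\<in>(\<Union>b\<in>underS r a. Y b). cell x)"
      by (auto simp: old_def region_def)
    then show ?thesis by (simp only: closedin_UN_cell)
  qed
  then have openG: "\<forall>G\<in>(\<lambda>G. G - old a) ` \<G>. openin K G" for a
    using \<G> by (auto intro: openin_diff)
  define R where "R a \<V> \<longleftrightarrow> (\<forall>V\<in>\<V>. openin (subtopology K (region (Y a))) V \<and> (\<exists>G\<in>\<G>. V \<subseteq> G - old a)) \<and>
        \<Union>\<V> = region (Y a) \<inter> (\<Union>\<G> - old a) \<and> point_finite \<V> (\<lambda>V. V)" for a \<V>
  have "\<exists>\<V>. R a \<V>" if "a \<in> X" for a
  proof -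
    have "\<Union>((\<lambda>G. G - old a) ` \<G>) = \<Union>\<G> - old a" by auto
    then show ?thesis
      using ref [OF that, unfolded point_finitely_refinable_def, THEN spec, THEN mp, OF openG [of a]]
      by (simp add: R_def)
  qed
  then obtain \<V> where "\<forall>a\<in>X. R a (\<V> a)"
    by metis
  note \<V> = this [unfolded R_def]
  have "\<forall>a\<in>X. \<forall>V\<in>\<V> a. \<exists>G. G \<in> \<G> \<and> V \<subseteq> G - old a"
    using \<V> by blast
  then obtain g where g: "\<forall>a\<in>X. \<forall>V\<in>\<V> a. g a V \<in> \<G> \<and> V \<subseteq> g a V - old a"
    by metis
  \<comment> \<open>The retraction moves points, so the pulled back set alone may leave every member
    of \<open>\<G>\<close>. Intersecting with \<open>g a V\<close> restores the refinement and loses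
    no point that the retraction fixes.\<close>
  define W where "W = (\<lambda>(a, V). region X \<inter> ({y \<in> topspace K. retract (Y a) y \<in> V} \<inter> g a V))"
  define I where "I = Sigma X \<V>"
  have top: "region X \<subseteq> topspace K"
    using closedin_subset [OF closedin_region] .
  show "\<exists>\<W>. (\<forall>V\<in>\<W>. openin (subtopology K (region X)) V \<and> (\<exists>G\<in>\<G>. V \<subseteq> G)) \<and>
        \<Union>\<W> = region X \<inter> \<Union>\<G> \<and> point_finite \<W> (\<lambda>V. V)"
  proof (intro exI [of _ "W ` I"] conjI ballI)
    fix U assume "U \<in> W ` I"
    then obtain a V where aV: "a \<in> X" "V \<in> \<V> a" "U = W (a, V)" by (auto simp: I_def)
    have "openin K {y \<in> topspace K. retract (Y a) y \<in> V}"
      using aV \<V> by (intro openin_retract_preimage Y) auto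
    moreover have "openin K (g a V)"
      using aV g \<G> by blast
    ultimately show "openin (subtopology K (region X)) U"
      unfolding aV(3) W_def prod.case by (intro openin_subtopology_Int2 openin_Int)
    show "\<exists>G\<in>\<G>. U \<subseteq> G"
      using aV g by (intro bexI [of _ "g a V"]) (auto simp: W_def)
  next
    show "\<Union>(W ` I) = region X \<inter> \<Union>\<G>"
    proof (intro equalityI subsetI)
      fix x assume "x \<in> \<Union>(W ` I)"
      then obtain a V where "a \<in> X" "V \<in> \<V> a" "x \<in> region X" "x \<in> g a V"
        by (auto simp: I_def W_def)
      with g show "x \<in> region X \<inter> \<Union>\<G>" by blast
    next
      fix x assume x: "x \<in> region X \<inter> \<Union>\<G>"
      let ?S = "{a \<in> X. x \<in> region (Y a)}"
      have "region X = (\<Union>a\<in>X. region (Y a))"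
        using XY unfolding region_def by blast
      then obtain a0 where a0: "a0 \<in> ?S" using x by blast
      have "wf (r - Id)"
        using r by (simp add: well_order_on_def)
      from this [unfolded wf_eq_minimal, THEN spec, THEN spec, THEN mp, OF a0]
      obtain a where a: "a \<in> ?S" "\<forall>b. (b, a) \<in> r - Id \<longrightarrow> b \<notin> ?S" ..
      have "b \<in> X" if "b \<in> underS r a" for b
        using that r by (auto simp: underS_def well_order_on_def linear_order_on_def
            partial_order_on_def preorder_on_def refl_on_def)
      then have "x \<notin> old a"
        using a(2) by (auto simp: old_def underS_def)
      then have "x \<in> \<Union>(\<V> a)"
        using a(1) \<V> x by auto
      then obtain V where V: "V \<in> \<V> a" "x \<in> V" by blast
      have "retract (Y a) x = x"
        using a(1) x top by (intro retract_eqI Y) auto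
      then have "x \<in> W (a, V)"
        using V g a(1) x top by (auto simp: W_def)
      then show "x \<in> \<Union>(W ` I)"
        using V a(1) by (auto simp: I_def)
    qed
  next
    have "finite {i \<in> I. y \<in> W i}" for y
    proof (cases "y \<in> topspace K")
      case True
      define B where "B = {a \<in> X. retract (Y a) y \<notin> old a}"
      have "finite B"
        unfolding B_def old_def using r Y mono True by (rule finite_new_stages)
      moreover have "finite {V \<in> \<V> a. retract (Y a) y \<in> V}" if "a \<in> B" for a
        using that \<V> by (auto simp: B_def point_finite_def)
      ultimately have "finite (SIGMA a:B. {V \<in> \<V> a. retract (Y a) y \<in> V})"
        by (rule finite_SigmaI)
      moreover have "{i \<in> I. y \<in> W i} \<subseteq> (SIGMA a:B. {V \<in> \<V> a. retract (Y a) y \<in> V})"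
      proof
        fix i assume i: "i \<in> {i \<in> I. y \<in> W i}"
        obtain a V where aV: "i = (a, V)" by (cases i)
        then have "a \<in> X" "V \<in> \<V> a" "retract (Y a) y \<in> V"
          using i by (auto simp: I_def W_def)
        moreover from this have "retract (Y a) y \<notin> old a"
          using g by blast
        ultimately show "i \<in> (SIGMA a:B. {V \<in> \<V> a. retract (Y a) y \<in> V})"
          by (simp add: aV B_def)
      qed
      ultimately show ?thesis by (rule finite_subset [rotated])
    next
      case False
      then have "{i \<in> I. y \<in> W i} = {}" by (auto simp: W_def)
      then show ?thesis by (simp only: finite.emptyI)
    qed
    then show "point_finite (W ` I) (\<lambda>V. V)"
      by (rule point_finite_image)
  qed
qed

lemma hereditarily_metacompact: "hereditarily_metacompact K"
proof -
  \<comment> \<open>Closedness under the operations does not confine \<open>X\<close> to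
    \<open>K\<close>, so the inclusion enters the induction as a premise of the predicate.\<close>
  have "X \<subseteq> topspace K \<longrightarrow> point_finitely_refinable K (region X)"
    if "finitary_closed box_reps X" for X
  proof (rule finitary_closed_induct [OF countable_box_reps that])
    fix X
    assume "finitary_closed box_reps X" "countable X"
    then show "X \<subseteq> topspace K \<longrightarrow> point_finitely_refinable K (region X)"
      using point_finitely_refinable_countable_model by blast
  next
    fix X r Y
    assume chain: "finitary_closed box_reps X" "well_order_on X r"
      "\<And>a. a \<in> X \<Longrightarrow> finitary_closed box_reps (Y a)"
      "\<And>a. a \<in> X \<Longrightarrow> Y a \<subseteq> topspace K \<longrightarrow> point_finitely_refinable K (region (Y a))"
      "\<And>a b. (a, b) \<in> r \<Longrightarrow> Y a \<subseteq> Y b" "X = (\<Union>a\<in>X. Y a)"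
    show "X \<subseteq> topspace K \<longrightarrow> point_finitely_refinable K (region X)"
    proof
      assume X: "X \<subseteq> topspace K"
      have Ytop: "Y a \<subseteq> topspace K" if "a \<in> X" for a
        using X chain(6) that by blast
      show "point_finitely_refinable K (region X)"
      proof (rule point_finitely_refinable_chain [of X r Y])
        show "model X" using X chain(1) by (simp add: model_def)
        show "model (Y a)" if "a \<in> X" for a
          using Ytop chain(3) that by (simp add: model_def)
        show "point_finitely_refinable K (region (Y a))" if "a \<in> X" for a
          using Ytop chain(4) that by simp
      qed (use chain in auto)
    qed
  qed
  then have "point_finitely_refinable K (region (topspace K))"
    using box_reps_subset by (simp add: finitary_closed_def)
  moreover have "region (topspace K) = topspace K"
    using cell_subset mem_cell_self by (auto simp: region_def)
  ultimately show ?thesis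
    by (simp add: point_finitely_refinable_imp_hereditarily_metacompact)
qed

end

section \<open>From metacompactness to cozero systems\<close>

text \<open>The cozero sets are found by induction on the order \<open>n\<close>: the points lying in exactly the members of
  a set \<open>F\<close> with \<open>card F = Suc n\<close>, and not yet covered, form a compact subset of \<open>\<Inter>F\<close>.\<close>

lemma point_finite_cozero_refinement:
  assumes K: "compact_space K" "Hausdorff_space K"
    and H: "\<forall>H\<in>\<H>. openin K H \<and> K closure_of H \<subseteq> \<Union>\<H>" and pf: "point_finite \<H> (\<lambda>H. H)"
  shows "\<exists>\<C>. (\<forall>C\<in>\<C>. cozero_in K C \<and> (\<exists>H\<in>\<H>. C \<subseteq> H)) \<and> \<Union>\<C> = \<Union>\<H> \<and> point_finite \<C> (\<lambda>C. C)"
proof -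
  define mem where "mem x = {H \<in> \<H>. x \<in> H}" for x
  have Ho: "openin K H" "K closure_of H \<subseteq> \<Union>\<H>" if "H \<in> \<H>" for H
    using bspec [OF H that] by auto
  have fin: "finite (mem x)" for x
    using pf by (simp add: mem_def point_finite_def)
  define I where "I n = {F. F \<subseteq> \<H> \<and> finite F \<and> card F = Suc n}" for n
  define good where "good n c \<longleftrightarrow> (\<forall>F\<in>I n. cozero_in K (c F) \<and> c F \<subseteq> \<Inter>F)"
    for n and c :: "'a set set \<Rightarrow> 'a set"
  define P where "P n W \<longleftrightarrow> openin K W \<and> {x \<in> \<Union>\<H>. card (mem x) \<le> n} \<subseteq> W \<and> (n = 0 \<longrightarrow> W = {})"
    for n W
  have "\<exists>W. \<forall>n. P n (W n) \<and> (\<exists>c. good n c \<and> W (Suc n) = W n \<union> (\<Union>F\<in>I n. c F))"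
  proof (rule dependent_nat_choice)
    have "card (mem x) \<noteq> 0" if "x \<in> \<Union>\<H>" for x
      using that fin [of x] by (auto simp: mem_def)
    then show "\<exists>W. P 0 W"
      by (intro exI [of _ "{}"]) (fastforce simp: P_def)
  next
    fix W and n :: nat
    assume W: "P n W"
    then have Wo: "openin K W" and small: "x \<in> W" if "x \<in> \<Union>\<H>" "card (mem x) \<le> n" for x
      using that by (auto simp: P_def)
    have Wopen: "openin K W" using W by (simp add: P_def)
    define E where "E F = {x \<in> \<Union>\<H>. mem x = F} - W" for F
    have "\<exists>C. cozero_in K C \<and> E F \<subseteq> C \<and> C \<subseteq> \<Inter>F" if F: "F \<in> I n" for F
    proof -
      obtain H0 where H0: "H0 \<in> F" using F by (fastforce simp: I_def)
      have EF: "E F \<subseteq> H" if "H \<in> F" for H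
        using that by (auto simp: E_def mem_def)
      have H0\<H>: "H0 \<in> \<H>"
        using H0 F by (auto simp: I_def)
      have "E F \<subseteq> topspace K"
        using EF [OF H0] openin_subset [OF Ho(1) [OF H0\<H>]] by (rule subset_trans)
      \<comment> \<open>Every member around a limit point \<open>x\<close> meets \<open>E F\<close>
        and thus belongs to \<open>F\<close>, so \<open>mem x \<subseteq> F\<close>. As
        \<open>x\<close> lies in the union of \<open>\<H>\<close> by the closure hypothesis, and
        outside the open set \<open>W\<close>, its order exceeds \<open>n\<close>; comparing
        cardinalities gives \<open>mem x = F\<close>.\<close>
      moreover have "x \<in> E F" if x: "x \<in> K closure_of E F" for x
      proof -
        have meets: "\<exists>y. y \<in> E F \<and> y \<in> T" if "openin K T" "x \<in> T" for T
          using x that unfolding in_closure_of by blast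
        have "x \<in> K closure_of H0"
          using x closure_of_mono [OF EF [OF H0]] by blast
        then have xH: "x \<in> \<Union>\<H>"
          using Ho(2) [OF H0\<H>] by blast
        have sub: "mem x \<subseteq> F"
        proof
          fix H' assume "H' \<in> mem x"
          then have "openin K H'" "x \<in> H'" "H' \<in> \<H>" using Ho(1) by (auto simp: mem_def)
          then obtain y where "y \<in> E F" "y \<in> H'" using meets by blast
          with \<open>H' \<in> \<H>\<close> show "H' \<in> F" by (auto simp: E_def mem_def)
        qed
        have "x \<notin> W"
          using meets [OF Wopen] by (auto simp: E_def)
        then have "\<not> card (mem x) \<le> n"
          using small [OF xH] by blast
        then have "card F \<le> card (mem x)"
          using F by (simp add: I_def)
        then have "mem x = F"
          using sub F card_seteq [of F "mem x"] by (auto simp: I_def)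
        with \<open>x \<notin> W\<close> xH show ?thesis by (simp add: E_def)
      qed
      ultimately have "closedin K (E F)"
        using closure_of_subset_eq [of "E F" K] by blast
      moreover have "openin K (\<Inter>F)"
        using F H0 Ho(1) by (intro openin_Inter) (auto simp: I_def)
      moreover have "E F \<subseteq> \<Inter>F" using EF by blast
      ultimately obtain C where "cozero_in K C" "E F \<subseteq> C" "C \<subseteq> \<Inter>F"
        by (rule compact_Hausdorff_cozero_between [OF K])
      then show ?thesis by (intro exI conjI)
    qed
    then obtain c where c: "\<forall>F\<in>I n. cozero_in K (c F) \<and> E F \<subseteq> c F \<and> c F \<subseteq> \<Inter>F"
      by metis
    have "P (Suc n) (W \<union> (\<Union>F\<in>I n. c F))"
      unfolding P_def
    proof (intro conjI impI subsetI)
      have "openin K (c F)" if "F \<in> I n" for F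
        using c that cozero_in_imp_openin by blast
      then show "openin K (W \<union> (\<Union>F\<in>I n. c F))"
        using Wopen by (intro openin_Un openin_Union) auto
      fix x assume "x \<in> {x \<in> \<Union>\<H>. card (mem x) \<le> Suc n}"
      then have x: "x \<in> \<Union>\<H>" "card (mem x) \<le> n \<or> card (mem x) = Suc n" by auto
      show "x \<in> W \<union> (\<Union>F\<in>I n. c F)"
      proof (cases "x \<in> W")
        case False
        then have "mem x \<in> I n"
          using x small [OF x(1)] fin [of x] by (auto simp: I_def mem_def)
        moreover have "x \<in> E (mem x)" using False x by (simp add: E_def)
        ultimately show ?thesis using c by blast
      qed simp
    qed simp
    moreover have "good n c" using c by (simp add: good_def)
    ultimately show "\<exists>W'. P (Suc n) W' \<and> (\<exists>c. good n c \<and> W' = W \<union> (\<Union>F\<in>I n. c F))" by blast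
  qed
  then obtain W where W: "\<forall>n. P n (W n) \<and> (\<exists>c. good n c \<and> W (Suc n) = W n \<union> (\<Union>F\<in>I n. c F))" ..
  then have "\<forall>n. \<exists>c. good n c \<and> W (Suc n) = W n \<union> (\<Union>F\<in>I n. c F)" by simp
  then obtain c where c: "\<forall>n. good n (c n) \<and> W (Suc n) = W n \<union> (\<Union>F\<in>I n. c n F)"
    by (rule choice [THEN exE])
  define J where "J = {F. F \<subseteq> \<H> \<and> finite F \<and> F \<noteq> {}}"
  \<comment> \<open>The shift undoes the \<open>Suc n\<close> in \<open>I n\<close>. Since
    \<open>d F \<subseteq> \<Inter>F\<close>, a point of \<open>d F\<close> has \<open>F\<close>
    among the subsets of its finite \<open>mem\<close>, which gives point-finiteness over all orders
    together.\<close>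
  define d where "d F = c (card F - 1) F" for F
  have JI: "F \<in> I (card F - 1)" if "F \<in> J" for F
    using that by (auto simp: I_def J_def card_gt_0_iff)
  have d: "cozero_in K (d F)" "d F \<subseteq> \<Inter>F" if "F \<in> J" for F
    using c JI [OF that] by (auto simp: good_def d_def)
  have Wd: "W n \<subseteq> (\<Union>F\<in>J. d F)" for n
  proof (induction n)
    case 0
    then show ?case using W by (auto simp: P_def)
  next
    case (Suc n)
    have "c n F \<subseteq> (\<Union>F\<in>J. d F)" if "F \<in> I n" for F
    proof -
      have "F \<in> J" "d F = c n F"
        using that by (auto simp: I_def J_def d_def)
      then show ?thesis using UN_upper [of F J d] by simp
    qed
    then show ?case using Suc c by auto
  qed
  have "\<Union>(d ` J) = \<Union>\<H>"
  proof (intro equalityI subsetI)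
    fix x assume "x \<in> \<Union>(d ` J)"
    then obtain F where F: "F \<in> J" "x \<in> d F" by blast
    then obtain H0 where "H0 \<in> F" "H0 \<in> \<H>" by (auto simp: J_def)
    with F(2) d(2) [OF F(1)] show "x \<in> \<Union>\<H>" by blast
  next
    fix x assume "x \<in> \<Union>\<H>"
    moreover have "{x \<in> \<Union>\<H>. card (mem x) \<le> n} \<subseteq> W n" for n
      using W by (simp add: P_def)
    ultimately have "x \<in> W (card (mem x))"
      by blast
    with Wd show "x \<in> \<Union>(d ` J)" by blast
  qed
  moreover have "cozero_in K C \<and> (\<exists>H\<in>\<H>. C \<subseteq> H)" if C: "C \<in> d ` J" for C
  proof -
    obtain F where F: "F \<in> J" "C = d F" using C by blast
    then obtain H0 where "H0 \<in> F" "H0 \<in> \<H>" by (auto simp: J_def)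
    then show ?thesis using d [OF F(1)] F(2) by auto
  qed
  moreover have "finite {F \<in> J. x \<in> d F}" for x
  proof (rule finite_subset)
    show "{F \<in> J. x \<in> d F} \<subseteq> Pow (mem x)"
    proof
      fix F assume "F \<in> {F \<in> J. x \<in> d F}"
      then have F: "F \<in> J" "x \<in> d F" by auto
      then show "F \<in> Pow (mem x)"
        using d(2) [OF F(1)] by (auto simp: mem_def J_def)
    qed
  qed (simp add: fin)
  then have "point_finite (d ` J) (\<lambda>C. C)"
    by (rule point_finite_image)
  ultimately show ?thesis by (intro exI [of _ "d ` J"]) simp
qed

text \<open>The families are indexed by themselves, which avoids changing the index type when systems
  are combined.\<close>

definition cozero_system_on :: "'a topology \<Rightarrow> 'a set \<Rightarrow> 'a set set set \<Rightarrow> bool"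
  where "cozero_system_on K G \<UU> \<longleftrightarrow>
    (\<forall>\<U>\<in>\<UU>. countable \<U> \<and> (\<forall>U\<in>\<U>. cozero_in K U)) \<and> \<Union>(\<Union>\<UU>) = G \<and>
    point_finite \<UU> Union \<and> (\<forall>x\<in>G. \<forall>y\<in>G. x \<noteq> y \<longrightarrow> (\<exists>U\<in>\<Union>\<UU>. (x \<in> U) \<noteq> (y \<in> U)))"

lemma cozero_system_on_openin:
  assumes "cozero_system_on K G \<UU>"
  shows "openin K G"
proof -
  have "openin K U" if "U \<in> \<Union>\<UU>" for U
    using assms that cozero_in_imp_openin unfolding cozero_system_on_def by blast
  then have "openin K (\<Union>(\<Union>\<UU>))" by blast
  then show ?thesis using assms by (simp add: cozero_system_on_def)
qed

text \<open>A point-finite cozero refinement \<open>\<D>\<close> localizes the given systems: each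
  \<open>D \<in> \<D>\<close> lies in some \<open>g D\<close> that carries a system, whose members
  are cut down to \<open>D\<close>. Two points are separated by \<open>D\<close> itself if it
  contains just one of them, and by a cut down member if it contains both.\<close>

lemma cozero_system_on_Union:
  assumes K: "compact_space K" "Hausdorff_space K" and meta: "hereditarily_metacompact K"
    and sys: "\<forall>G\<in>\<G>. \<exists>\<UU>. cozero_system_on K G \<UU>"
  shows "\<exists>\<UU>. cozero_system_on K (\<Union>\<G>) \<UU>"
proof -
  have Go: "openin K G" if "G \<in> \<G>" for G
    using sys that cozero_system_on_openin by blast
  then have UG: "openin K (\<Union>\<G>)" by blast
  have top: "\<Union>\<G> \<subseteq> topspace K" using openin_subset [OF UG] .
  \<comment> \<open>The closure condition passes to every refinement and is the hypothesis of
    \<open>point_finite_cozero_refinement\<close>; regularity of \<open>K\<close> shows that such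
    \<open>W\<close> still cover \<open>\<Union>\<G>\<close>.\<close>
  define \<C> where "\<C> = {W. openin K W \<and> K closure_of W \<subseteq> \<Union>\<G> \<and> (\<exists>G\<in>\<G>. W \<subseteq> G)}"
  have CG: "W \<subseteq> \<Union>\<G>" if "W \<in> \<C>" for W
    using that by (auto simp: \<C>_def)
  have "\<forall>C\<in>\<C>. openin (subtopology K (\<Union>\<G>)) C"
    using CG UG by (auto simp: openin_open_subtopology \<C>_def)
  moreover have "\<Union>\<C> = topspace (subtopology K (\<Union>\<G>))"
  proof -
    have "\<Union>\<G> \<subseteq> \<Union>\<C>"
    proof
      fix x assume "x \<in> \<Union>\<G>"
      then obtain G where G: "G \<in> \<G>" "x \<in> G" by blast
      have "neighbourhood_base_of (closedin K) K"
        using compact_Hausdorff_imp_regular_space [OF K] neighbourhood_base_of_closedin by blast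
      then obtain U V where UV: "openin K U" "closedin K V" "x \<in> U" "U \<subseteq> V" "V \<subseteq> G"
        using Go [OF G(1)] G(2) unfolding neighbourhood_base_of by meson
      have "K closure_of U \<subseteq> V" using UV(4,2) by (rule closure_of_minimal)
      then have "U \<in> \<C>" using UV G(1) by (auto simp: \<C>_def)
      with UV(3) show "x \<in> \<Union>\<C>" by blast
    qed
    moreover have "\<Union>\<C> \<subseteq> \<Union>\<G>" using CG by (rule Union_least)
    ultimately show ?thesis
      by (simp only: topspace_subtopology_subset [OF top])
  qed
  ultimately obtain \<H> where \<H>: "\<forall>V\<in>\<H>. openin (subtopology K (\<Union>\<G>)) V \<and> (\<exists>C\<in>\<C>. V \<subseteq> C)"
    "\<Union>\<H> = topspace (subtopology K (\<Union>\<G>))" "point_finite \<H> (\<lambda>V. V)"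
    using meta [unfolded hereditarily_metacompact_def metacompact_space_def, THEN spec, THEN mp,
        OF top, THEN spec, of \<C>] by auto
  have UH: "\<Union>\<H> = \<Union>\<G>" using \<H>(2) top by auto
  have HC: "\<exists>C\<in>\<C>. H \<subseteq> C" if "H \<in> \<H>" for H using \<H>(1) that by blast
  have "\<forall>H\<in>\<H>. openin K H \<and> K closure_of H \<subseteq> \<Union>\<H>"
  proof (intro ballI conjI)
    fix H assume H: "H \<in> \<H>"
    show "openin K H"
      using \<H>(1) H UG openin_trans_full by blast
    obtain C where "C \<in> \<C>" "H \<subseteq> C" using HC [OF H] by blast
    then show "K closure_of H \<subseteq> \<Union>\<H>"
      using closure_of_mono [of H C K] by (auto simp: UH \<C>_def)
  qed
  from point_finite_cozero_refinement [OF K this \<H>(3), unfolded UH]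
  obtain \<D> where "(\<forall>C\<in>\<D>. cozero_in K C \<and> (\<exists>H\<in>\<H>. C \<subseteq> H)) \<and> \<Union>\<D> = \<Union>\<G> \<and>
    point_finite \<D> (\<lambda>C. C)" ..
  then have \<D>: "\<forall>C\<in>\<D>. cozero_in K C \<and> (\<exists>H\<in>\<H>. C \<subseteq> H)" "\<Union>\<D> = \<Union>\<G>"
    "point_finite \<D> (\<lambda>C. C)"
    by simp_all
  have "\<exists>\<UU> G. D \<subseteq> G \<and> cozero_system_on K G \<UU>" if D: "D \<in> \<D>" for D
  proof -
    obtain H where H: "H \<in> \<H>" "D \<subseteq> H" using \<D>(1) D by blast
    obtain C where C: "C \<in> \<C>" "H \<subseteq> C" using HC [OF H(1)] by blast
    obtain G where G: "G \<in> \<G>" "C \<subseteq> G" using C(1) by (auto simp: \<C>_def)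
    obtain \<UU> where "cozero_system_on K G \<UU>" using bspec [OF sys G(1)] by (rule exE)
    moreover have "D \<subseteq> G" using H(2) C(2) G(2) by blast
    ultimately show ?thesis by (intro exI conjI)
  qed
  then obtain \<V> where "\<forall>D\<in>\<D>. \<exists>G. D \<subseteq> G \<and> cozero_system_on K G (\<V> D)"
    by metis
  then obtain g where g: "\<forall>D\<in>\<D>. D \<subseteq> g D \<and> cozero_system_on K (g D) (\<V> D)"
    by metis
  have sysD: "cozero_system_on K (g D) (\<V> D)" "D \<subseteq> g D" if "D \<in> \<D>" for D
    using g that by auto
  \<comment> \<open>The singletons put the sets \<open>D\<close> themselves into the system.
    Point-finiteness needs the cutting: a point meets families derived from finitely many
    \<open>D\<close> only, and finitely many from each.\<close>
  define \<UU> where "\<UU> = (\<lambda>D. {D}) ` \<D> \<union> (\<lambda>(D, \<U>). (\<inter>) D ` \<U>) ` Sigma \<D> \<V>"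
  have "cozero_system_on K (\<Union>\<G>) \<UU>"
    unfolding cozero_system_on_def
  proof (intro conjI ballI impI)
    fix \<U> assume \<U>: "\<U> \<in> \<UU>"
    then consider D where "D \<in> \<D>" "\<U> = {D}"
      | D \<W> where "D \<in> \<D>" "\<W> \<in> \<V> D" "\<U> = (\<inter>) D ` \<W>"
      by (auto simp: \<UU>_def)
    then have "countable \<U> \<and> (\<forall>U\<in>\<U>. cozero_in K U)"
    proof cases
      case 1
      then show ?thesis using \<D>(1) by simp
    next
      case 2
      then have "countable \<W>" "\<forall>U\<in>\<W>. cozero_in K U"
        using sysD(1) [OF 2(1)] by (auto simp: cozero_system_on_def)
      with 2 \<D>(1) show ?thesis by (auto intro: cozero_in_Int)
    qed
    then show "countable \<U>" "\<And>U. U \<in> \<U> \<Longrightarrow> cozero_in K U" by auto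
  next
    have sub: "\<Union>\<U> \<subseteq> \<Union>\<D>" if "\<U> \<in> \<UU>" for \<U>
      using that by (auto simp: \<UU>_def)
    have "\<D> \<subseteq> \<Union>\<UU>"
      by (auto simp: \<UU>_def)
    then have "\<Union>\<D> \<subseteq> \<Union>(\<Union>\<UU>)" by (rule Union_mono)
    moreover have "\<Union>(\<Union>\<UU>) \<subseteq> \<Union>\<D>"
    proof
      fix x assume "x \<in> \<Union>(\<Union>\<UU>)"
      then obtain \<U> where \<U>: "\<U> \<in> \<UU>" "x \<in> \<Union>\<U>" by blast
      show "x \<in> \<Union>\<D>" using sub [OF \<U>(1)] \<U>(2) by (rule subsetD)
    qed
    ultimately show "\<Union>(\<Union>\<UU>) = \<Union>\<G>"
      unfolding \<D>(2) [symmetric] by (intro equalityI)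
  next
    show "point_finite \<UU> Union"
      unfolding point_finite_def
    proof
      fix x
      have fin: "finite {D \<in> \<D>. x \<in> D}"
        using \<D>(3) by (simp add: point_finite_def)
      have "finite {\<U> \<in> \<V> D. x \<in> \<Union>\<U>}" if "D \<in> \<D>" for D
        using sysD(1) [OF that] by (simp add: cozero_system_on_def point_finite_def)
      then have "finite (SIGMA D:{D \<in> \<D>. x \<in> D}. {\<U> \<in> \<V> D. x \<in> \<Union>\<U>})"
        using fin by (intro finite_SigmaI) auto
      then have "finite ((\<lambda>D. {D}) ` {D \<in> \<D>. x \<in> D} \<union>
          (\<lambda>(D, \<U>). (\<inter>) D ` \<U>) ` (SIGMA D:{D \<in> \<D>. x \<in> D}. {\<U> \<in> \<V> D. x \<in> \<Union>\<U>}))"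
        using fin by simp
      moreover have "{\<U> \<in> \<UU>. x \<in> \<Union>\<U>} \<subseteq> (\<lambda>D. {D}) ` {D \<in> \<D>. x \<in> D} \<union>
          (\<lambda>(D, \<U>). (\<inter>) D ` \<U>) ` (SIGMA D:{D \<in> \<D>. x \<in> D}. {\<U> \<in> \<V> D. x \<in> \<Union>\<U>})"
        by (force simp: \<UU>_def)
      ultimately show "finite {\<U> \<in> \<UU>. x \<in> \<Union>\<U>}" by (rule finite_subset [rotated])
    qed
  next
    fix x y assume xy: "x \<in> \<Union>\<G>" "y \<in> \<Union>\<G>" "x \<noteq> y"
    then obtain D where D: "D \<in> \<D>" "x \<in> D" using \<D>(2) by blast
    show "\<exists>U\<in>\<Union>\<UU>. (x \<in> U) \<noteq> (y \<in> U)"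
    proof (cases "y \<in> D")
      case True
      then have "x \<in> g D" "y \<in> g D" using D sysD(2) by auto
      then obtain \<W> U where U: "\<W> \<in> \<V> D" "U \<in> \<W>" "(x \<in> U) \<noteq> (y \<in> U)"
        using sysD(1) [OF D(1)] xy(3) unfolding cozero_system_on_def by blast
      then have "D \<inter> U \<in> \<Union>\<UU>"
        using D(1) unfolding \<UU>_def by force
      moreover have "(x \<in> D \<inter> U) \<noteq> (y \<in> D \<inter> U)" using True D U by blast
      ultimately show ?thesis by (rule bexI [rotated])
    next
      case False
      moreover have "D \<in> \<Union>\<UU>" using D by (auto simp: \<UU>_def)
      ultimately show ?thesis using D(2) by blast
    qed
  qed
  then show ?thesis by (rule exI)
qed

text \<open>One countable family is added. It consists of a cozero set \<open>C\<close> and of parts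
  of \<open>C\<close> that separate the points of \<open>C\<close> outside \<open>G\<close>; these
  lie in the second countable piece \<open>S\<close>. If exactly one of two points lies in
  \<open>G\<close>, an old member containing it separates them, because all old members are subsets
  of \<open>G\<close>.\<close>

lemma cozero_system_on_extend:
  assumes K: "compact_space K" "Hausdorff_space K"
    and sys: "cozero_system_on K G \<UU>" and ne: "G \<noteq> topspace K"
    and sc: "\<forall>A \<subseteq> topspace K. A \<noteq> {} \<longrightarrow>
      (\<exists>U. U \<noteq> {} \<and> openin (subtopology K A) U \<and> second_countable (subtopology K U))"
  shows "\<exists>G' \<UU>'. cozero_system_on K G' \<UU>' \<and> \<not> G' \<subseteq> G"
proof -
  have "topspace K - G \<noteq> {}"
    using ne openin_subset [OF cozero_system_on_openin [OF sys]] by blast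
  then have "\<exists>S. S \<noteq> {} \<and> openin (subtopology K (topspace K - G)) S \<and> second_countable (subtopology K S)"
    using sc [THEN spec, of "topspace K - G"] by blast
  then obtain S where S: "S \<noteq> {}" "openin (subtopology K (topspace K - G)) S"
    "second_countable (subtopology K S)" by blast
  then obtain V where V: "openin K V" "S = V \<inter> (topspace K - G)"
    unfolding openin_subtopology by blast
  have Stop: "S \<subseteq> topspace K" using V by blast
  obtain x where x: "x \<in> S" using S by blast
  then have "x \<in> V" using V by blast
  then obtain C where C: "cozero_in K C" "x \<in> C" "C \<subseteq> V"
    by (rule compact_Hausdorff_cozero_nbhd [OF K V(1)])
  from second_countable_separating_functions [OF K Stop S(3) Stop S(3)]
  obtain \<Phi> where \<Phi>: "countable \<Phi> \<and> (\<forall>f\<in>\<Phi>. continuous_map K euclideanreal f) \<and>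
    (\<forall>p\<in>S. \<forall>q\<in>S. p \<noteq> q \<longrightarrow> (\<exists>f\<in>\<Phi>. f p \<noteq> f q))" ..
  define \<C> where "\<C> = insert C ((\<lambda>(f, q). C \<inter> {y \<in> topspace K. q < f y}) ` (\<Phi> \<times> \<rat>))"
  have Ctop: "C \<subseteq> topspace K"
    using cozero_in_imp_openin [OF C(1)] by (rule openin_subset)
  have cnt: "countable \<C>"
    using \<Phi> by (auto simp: \<C>_def intro!: countable_SIGMA countable_rat)
  have coz: "cozero_in K U" if "U \<in> \<C>" for U
    using that C(1) \<Phi> by (auto simp: \<C>_def intro!: cozero_in_Int cozero_in_greaterI)
  have UC: "\<Union>\<C> = C" by (auto simp: \<C>_def)
  have sepS: "\<exists>U\<in>\<C>. (y \<in> U) \<noteq> (z \<in> U)" if yz: "y \<in> S \<inter> C" "z \<in> S \<inter> C" "y \<noteq> z" for y z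
  proof -
    have "\<exists>f\<in>\<Phi>. f y \<noteq> f z"
      by (rule \<Phi> [THEN conjunct2, THEN conjunct2, rule_format]) (use yz in auto)
    then obtain f where f: "f \<in> \<Phi>" "f y \<noteq> f z" ..
    have mem: "C \<inter> {w \<in> topspace K. q < f w} \<in> \<C>" if "q \<in> \<rat>" for q
      unfolding \<C>_def using that f(1) by (intro insertI2 image_eqI [of _ _ "(f, q)"]) auto
    have "\<exists>q\<in>\<rat>. (q < f y) \<noteq> (q < f z)"
    proof (cases "f y < f z")
      case True
      from True [THEN Rats_dense_in_real] obtain q where "q \<in> \<rat>" "f y < q" "q < f z" by blast
      then show ?thesis by (intro bexI [of _ q]) auto
    next
      case False
      then have "f z < f y" using f by simp
      from Rats_dense_in_real [OF this] obtain q where "q \<in> \<rat>" "f z < q" "q < f y" by blast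
      then show ?thesis by (intro bexI [of _ q]) auto
    qed
    then obtain q where q: "q \<in> \<rat>" "(q < f y) \<noteq> (q < f z)" ..
    show ?thesis
      using mem [OF q(1)] by (rule bexI [rotated]) (use q(2) yz Ctop in auto)
  qed
  have sysU: "\<forall>\<U>\<in>\<UU>. countable \<U> \<and> (\<forall>U\<in>\<U>. cozero_in K U)" "\<Union>(\<Union>\<UU>) = G" "point_finite \<UU> Union"
    "\<forall>x\<in>G. \<forall>y\<in>G. x \<noteq> y \<longrightarrow> (\<exists>U\<in>\<Union>\<UU>. (x \<in> U) \<noteq> (y \<in> U))"
    using sys by (simp_all add: cozero_system_on_def)
  have "cozero_system_on K (G \<union> C) (insert \<C> \<UU>)"
    unfolding cozero_system_on_def
  proof (intro conjI ballI impI)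
    show "countable \<U>" if "\<U> \<in> insert \<C> \<UU>" for \<U>
      using that cnt sysU(1) by auto
    show "cozero_in K U" if "\<U> \<in> insert \<C> \<UU>" "U \<in> \<U>" for \<U> U
      using that coz sysU(1) by auto
    show "\<Union>(\<Union>(insert \<C> \<UU>)) = G \<union> C"
      using UC sysU(2) by auto
    show "point_finite (insert \<C> \<UU>) Union"
      unfolding point_finite_def
    proof
      fix y
      have "finite (insert \<C> {\<U> \<in> \<UU>. y \<in> \<Union>\<U>})"
        using sysU(3) by (simp add: point_finite_def)
      then show "finite {\<U> \<in> insert \<C> \<UU>. y \<in> \<Union>\<U>}"
        by (rule finite_subset [rotated]) auto
    qed
    fix y z assume yz: "y \<in> G \<union> C" "z \<in> G \<union> C" "y \<noteq> z"
    have sepG: "\<exists>U\<in>\<Union>\<UU>. (y \<in> U) \<noteq> (z \<in> U)" if "(y \<in> G) \<noteq> (z \<in> G)"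
      using that unfolding sysU(2) [symmetric] by blast
    consider "y \<in> G" "z \<in> G" | "(y \<in> G) \<noteq> (z \<in> G)" | "y \<notin> G" "z \<notin> G" by blast
    then show "\<exists>U\<in>\<Union>(insert \<C> \<UU>). (y \<in> U) \<noteq> (z \<in> U)"
    proof cases
      case 1
      then have "\<exists>U\<in>\<Union>\<UU>. (y \<in> U) \<noteq> (z \<in> U)" using sysU(4) yz(3) by blast
      then show ?thesis by auto
    next
      case 2
      then show ?thesis using sepG by auto
    next
      case 3
      then have "y \<in> S \<inter> C" "z \<in> S \<inter> C" using yz V(2) C(3) Ctop by auto
      then show ?thesis using sepS [OF _ _ yz(3)] by auto
    qed
  qed
  moreover have "\<not> G \<union> C \<subseteq> G" using x V C by blast
  ultimately show ?thesis by (intro exI conjI)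
qed

lemma hereditarily_metacompact_imp_NY_compact:
  assumes K: "compact_space K" "Hausdorff_space K" and meta: "hereditarily_metacompact K"
    and sc: "\<forall>A \<subseteq> topspace K. A \<noteq> {} \<longrightarrow>
      (\<exists>U. U \<noteq> {} \<and> openin (subtopology K A) U \<and> second_countable (subtopology K U))"
  shows "NY_compact K"
proof -
  define \<G> where "\<G> = {G. \<exists>\<UU>. cozero_system_on K G \<UU>}"
  obtain \<UU> where \<UU>: "cozero_system_on K (\<Union>\<G>) \<UU>"
    using cozero_system_on_Union [OF K meta, of \<G>] by (auto simp: \<G>_def)
  have "\<Union>\<G> = topspace K"
  proof (rule ccontr)
    assume "\<Union>\<G> \<noteq> topspace K"
    then obtain G' \<UU>' where "cozero_system_on K G' \<UU>'" "\<not> G' \<subseteq> \<Union>\<G>"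
      using cozero_system_on_extend [OF K \<UU> _ sc] by blast
    then show False by (auto simp: \<G>_def)
  qed
  \<comment> \<open>The families serve as their own indices; the passage to
    \<open>NY_compact\<close> goes through \<open>NY_compactI\<close>, which accepts any index
    type.\<close>
  with \<UU> have "point_finite_cozero_system K \<UU> (\<lambda>\<U>. \<U>)"
    unfolding cozero_system_on_def point_finite_cozero_system_def T0_separating_def
    by (simp add: eta_contract_eq)
  then show ?thesis
    by (rule point_finite_cozero_system_imp_NY_compact [OF K(1)])
qed

theorem theorem4p1:
  fixes K :: "'a topology"
  assumes "completely_regular_space K" and "Hausdorff_space K" and "compact_space K"
  shows "(NY_compact K
      \<longleftrightarrow>
        (\<exists>(\<Gamma> :: ('a \<times> nat) set) \<U>.
           T0_separating K (\<Union>\<gamma>\<in>\<Gamma>. \<U> \<gamma>) \<and>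
           (\<forall>\<gamma>\<in>\<Gamma>. countable (\<U> \<gamma>) \<and> (\<forall>U \<in> \<U> \<gamma>. cozero_in K U)) \<and>
           point_finite \<Gamma> (\<lambda>\<gamma>. \<Union>(\<U> \<gamma>))))
    \<and> (NY_compact K
      \<longleftrightarrow>
        (\<exists>\<A>. \<Union>\<A> = topspace K \<and> closure_preserving K \<A> \<and>
           (\<forall>A\<in>\<A>. compactin K A \<and> metrizable_space (subtopology K A))))
    \<and> (NY_compact K
      \<longleftrightarrow>
        hereditarily_metacompact K \<and>
        (\<forall>A \<subseteq> topspace K. A \<noteq> {} \<longrightarrow>
           (\<exists>U. U \<noteq> {} \<and> openin (subtopology K A) U \<and> second_countable (subtopology K U))))"
    (is "(_ \<longleftrightarrow> ?ii) \<and> (_ \<longleftrightarrow> ?iii) \<and> (_ \<longleftrightarrow> ?iv)")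
proof -
  note K = \<open>compact_space K\<close> \<open>Hausdorff_space K\<close>
  have ii: "?ii \<longleftrightarrow> (\<exists>(\<Gamma> :: ('a \<times> nat) set) \<U>. point_finite_cozero_system K \<Gamma> \<U>)"
    unfolding point_finite_cozero_system_def ..
  have "NY_compact K" if ?ii
    using that unfolding ii by (elim exE) (rule point_finite_cozero_system_imp_NY_compact [OF K(1)])
  moreover have ?ii if "NY_compact K"
    unfolding ii using that by (rule NY_compact_imp_point_finite_cozero_system)
  moreover have ?iii if ?ii
    using that unfolding ii by (elim exE) (rule point_finite_cozero_system_imp_closure_preserving [OF K(1)])
  moreover have ?iv if ?iii
  proof -
    obtain \<A> where \<A>: "\<Union>\<A> = topspace K" "closure_preserving K \<A>"
      "\<forall>A\<in>\<A>. compactin K A \<and> metrizable_space (subtopology K A)"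
      using \<open>?iii\<close> by (elim exE conjE)
    interpret closure_preserving_metrizable_cover K \<A>
      by unfold_locales (use K \<A> in auto)
    show ?iv
      using hereditarily_metacompact ex_openin_second_countable by simp
  qed
  moreover have "NY_compact K" if ?iv
    using that hereditarily_metacompact_imp_NY_compact [OF K] by simp
  ultimately show ?thesis by argo
qed

end
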